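(* Let $K$ be a field, $Q$ a finite quiver, $\mathcal B$ the set of finite directed paths of $Q$, and $\succ$ an admissible order on $\mathcal B$. Let $W\colon Q_1\to G$ be a weight function, where $G$ is a group. Let $\mathcal T\subset\mathcal B$ be a finite tip-reduced set of paths of length at least $2$. For each $t\in\mathcal T$ let $\mathcal S(t)=\mathcal N(t)\setminus\mathcal N^W(t)$ and let $\varphi_t\colon\mathcal S(t)\to K$ be such that $\varphi_t\equiv0$. Then, for $\varphi=\{\varphi_t\mid t\in\mathcal T\}$, $$\mathcal V^W_{\mathcal T}\simeq\mathcal V_{\mathcal T}(\varphi),$$ and thus $\mathcal V^W_{\mathcal T}$ is a special subvariety of $\mathcal V_{\mathcal T}$, and therefore $\mathcal V^W_{\mathcal T}$ is an affine algebraic variety.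
   Context: Vertices of $Q$ are regarded as paths of length $0$ in $\mathcal B$; paths are read left to right; $\ell(p)$ is the length of $p$. For $p,q\in\mathcal B$, $p$ is a subpath of $q$ if $q=rps$ for some $r,s\in\mathcal B$. An admissible order $\succ$ on $\mathcal B$ is a well-order such that: if $p\succ q$ then $pr\succ qr$ whenever $pr,qr$ are nonzero, and $sp\succ sq$ whenever $sp,sq$ are nonzero; and if $p=rqs\neq0$ then $p\succeq q$. For $0\ne x=\sum_p\alpha_pp\in KQ$, $\mathrm{tip}(x)$ is the $\succ$-largest $p$ with $\alpha_p\neq0$; $\mathrm{tip}(X)=\{\mathrm{tip}(x)\mid 0\neq x\in X\}$. A set $X$ is tip-reduced if for distinct nonzero $x,y\in X$, $\mathrm{tip}(x)$ is not a subpath of $\mathrm{tip}(y)$. Paths are parallel, $p\|q$, if they have the same origin and the same terminus vertices. All ideals are two-sided. For an ideal $I$ put $I_{Mon}=\langle\mathrm{tip}(I)\rangle$. There is a unique minimal set $\mathcal T_I$ of paths generating $I_{Mon}$, and for each $t\in\mathcal T_I$ there is a unique $g_t\in I$ with $t-g_t\in\mathrm{Span}_K(\mathcal B\setminus\mathrm{tip}(I))$; the set $\{g_t\mid t\in\mathcal T_I\}$ is the reduced Gröbner basis of $I$. Let $\mathcal N$ be the set of paths having no element of $\mathcal T$ as a subpath, and for $t\in\mathcal T$ let $\mathcal N(t)=\{n\in\mathcal N\mid n\|t,\ t\succ n\}$, $D=\sum_{t\in\mathcal T}|\mathcal N(t)|$. For $\mathbf c=(c_{t,n})\in K^D$ ($t\in\mathcal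 T$, $n\in\mathcal N(t)$, for each $t$ only finitely many $c_{t,n}$ nonzero) let $\mathcal G_{\mathbf c}=\{t-\sum_{n\in\mathcal N(t)}c_{t,n}n\mid t\in\mathcal T\}$. Then $\mathcal V_{\mathcal T}=\{\mathbf c\in K^D\mid \mathcal G_{\mathbf c}\text{ is the reduced Gröbner basis of }\langle\mathcal G_{\mathbf c}\rangle\}$. Given subsets $\mathcal S(t)\subseteq\mathcal N(t)$ and maps $\varphi_t\colon\mathcal S(t)\to K$ for $t\in\mathcal T$, with $\varphi=\{\varphi_t\mid t\in\mathcal T\}$, the special subvariety of $\mathcal V_{\mathcal T}$ associated to $\varphi$ is $\mathcal V_{\mathcal T}(\varphi)=\{\mathbf c\in\mathcal V_{\mathcal T}\mid c_{t,n}=\varphi_t(n)\text{ for all }t\in\mathcal T,\ n\in\mathcal S(t)\}$. A weight function $W\colon Q_1\to G$ is extended to $\mathcal B$ by $W(a_1\cdots a_k)=W(a_1)\cdots W(a_k)$ for arrows $a_i$ and $W(v)=1_G$ for vertices $v$. Let $\mathcal N^W(t)=\{n\in\mathcal N\mid n\|t,\ \ell(n)\ge1,\ t\succ n,\ W(n)=W(t)\}$ and $D^W=\sum_{t\in\mathcal T}|\mathcal N^W(t)|$. For $\mathbf c=(c_{t,n})\in K^{D^W}$ ($t\in\mathcal T$, $n\in\mathcal N^W(t)$, with the same finiteness convention) let $\mathcal G=\{t-\sum_{n\in\mathcal N^W(t)}c_{t,n}n\mid t\in\mathcal T\}$; then $\mathcal V^W_{\mathcal T}$ is the set of $\mathbf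 c\in K^{D^W}$ for which $\mathcal G$ is the reduced Gröbner basis of $\langle\mathcal G\rangle$.
   Formalization: When D or D^W is infinite, "affine algebraic variety" and "≃" are read in the ind-variety sense (functions polynomial on each finite-dimensional coordinate subspace), since zero sets of ordinary polynomials would make the claim false; for finite D the usual notions are meant. *)

theory Defs
  imports
    "HOL-Algebra.Ideal"
    "HOL-Library.Poly_Mapping"
    "Graph_Theory.Digraph"
    "Graph_Theory.Arc_Walk"
begin

section \<open>Paths of a quiver\<close>

text \<open>
  A quiver is a multi-digraph with loops allowed. A path is its origin together with its list
  of arrows, read left to right; the vertex \<open>v\<close> is the path \<open>(v, [])\<close>.
\<close>

type_synonym ('v, 'e) qpath = "'v \<times> 'e list"

definition paths :: "('v, 'e) pre_digraph \<Rightarrow> ('v, 'e) qpath set" where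
  "paths Q = {p. \<exists>v. pre_digraph.awalk Q (fst p) (snd p) v}"

definition terminus :: "('v, 'e) pre_digraph \<Rightarrow> ('v, 'e) qpath \<Rightarrow> 'v" where
  "terminus Q p = last (pre_digraph.awalk_verts Q (fst p) (snd p))"

definition path_length :: "('v, 'e) qpath \<Rightarrow> nat" where
  "path_length p = length (snd p)"

definition parallel :: "('v, 'e) pre_digraph \<Rightarrow> ('v, 'e) qpath \<Rightarrow> ('v, 'e) qpath \<Rightarrow> bool" where
  "parallel Q p q \<longleftrightarrow> fst p = fst q \<and> terminus Q p = terminus Q q"

text \<open>
  The product \<open>pq\<close> of two paths in the path algebra is nonzero iff \<open>composable Q p q\<close>,
  and then it is \<open>conc p q\<close>.
\<close>

definition composable :: "('v, 'e) pre_digraph \<Rightarrow> ('v, 'e) qpath \<Rightarrow> ('v, 'e) qpath \<Rightarrow> bool" where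
  "composable Q p q \<longleftrightarrow> terminus Q p = fst q"

definition conc :: "('v, 'e) qpath \<Rightarrow> ('v, 'e) qpath \<Rightarrow> ('v, 'e) qpath" where
  "conc p q = (fst p, snd p @ snd q)"

definition subpath :: "('v, 'e) pre_digraph \<Rightarrow> ('v, 'e) qpath \<Rightarrow> ('v, 'e) qpath \<Rightarrow> bool" where
  "subpath Q p q \<longleftrightarrow> (\<exists>r\<in>paths Q. \<exists>s\<in>paths Q.
     composable Q r p \<and> composable Q p s \<and> q = conc r (conc p s))"

text \<open>
  An order is given by its reflexive relation: \<open>(p, q) \<in> ord\<close> means that \<open>p\<close> is at most \<open>q\<close>.
\<close>

definition greater :: "('v, 'e) qpath rel \<Rightarrow> ('v, 'e) qpath \<Rightarrow> ('v, 'e) qpath \<Rightarrow> bool" where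
  "greater ord p q \<longleftrightarrow> (q, p) \<in> ord \<and> p \<noteq> q"

definition admissible_order :: "('v, 'e) pre_digraph \<Rightarrow> ('v, 'e) qpath rel \<Rightarrow> bool" where
  "admissible_order Q ord \<longleftrightarrow>
     well_order_on (paths Q) ord \<and>
     (\<forall>p\<in>paths Q. \<forall>q\<in>paths Q. \<forall>r\<in>paths Q. greater ord p q \<longrightarrow>
        composable Q p r \<longrightarrow> composable Q q r \<longrightarrow> greater ord (conc p r) (conc q r)) \<and>
     (\<forall>p\<in>paths Q. \<forall>q\<in>paths Q. \<forall>s\<in>paths Q. greater ord p q \<longrightarrow>
        composable Q s p \<longrightarrow> composable Q s q \<longrightarrow> greater ord (conc s p) (conc s q)) \<and>
     (\<forall>p\<in>paths Q. \<forall>q\<in>paths Q. \<forall>r\<in>paths Q. \<forall>s\<in>paths Q.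
        composable Q r q \<longrightarrow> composable Q q s \<longrightarrow> p = conc r (conc q s) \<longrightarrow> (q, p) \<in> ord)"

section \<open>The path algebra\<close>

type_synonym ('v, 'e, 'k) qelem = "('v, 'e) qpath \<Rightarrow>\<^sub>0 'k"

definition Span :: "('v, 'e) qpath set \<Rightarrow> ('v, 'e, 'k::field) qelem set" where
  "Span X = {x. Poly_Mapping.keys x \<subseteq> X}"

definition path_elem :: "('v, 'e) qpath \<Rightarrow> ('v, 'e, 'k::field) qelem" where
  "path_elem p = Poly_Mapping.single p 1"

definition path_mult :: "('v, 'e) pre_digraph \<Rightarrow>
    ('v, 'e, 'k::field) qelem \<Rightarrow> ('v, 'e, 'k) qelem \<Rightarrow> ('v, 'e, 'k) qelem" where
  "path_mult Q x y = (\<Sum>p\<in>Poly_Mapping.keys x. \<Sum>q\<in>Poly_Mapping.keys y.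
     if composable Q p q
     then Poly_Mapping.single (conc p q) (Poly_Mapping.lookup x p * Poly_Mapping.lookup y q)
     else 0)"

definition path_algebra :: "('v, 'e) pre_digraph \<Rightarrow> ('v, 'e, 'k::field) qelem ring" where
  "path_algebra Q = \<lparr>carrier = Span (paths Q), monoid.mult = path_mult Q,
     one = (\<Sum>v\<in>verts Q. path_elem (v, [])), zero = 0, add = (+)\<rparr>"

section \<open>Tips and reduced Groebner bases\<close>

definition tip :: "('v, 'e) qpath rel \<Rightarrow> ('v, 'e, 'k::field) qelem \<Rightarrow> ('v, 'e) qpath" where
  "tip ord x = (THE p. p \<in> Poly_Mapping.keys x \<and> (\<forall>q\<in>Poly_Mapping.keys x. (q, p) \<in> ord))"

definition tips :: "('v, 'e) qpath rel \<Rightarrow> ('v, 'e, 'k::field) qelem set \<Rightarrow> ('v, 'e) qpath set" where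
  "tips ord X = {tip ord x | x. x \<in> X \<and> x \<noteq> 0}"

definition tip_reduced :: "('v, 'e) pre_digraph \<Rightarrow> ('v, 'e) qpath rel \<Rightarrow>
    ('v, 'e, 'k::field) qelem set \<Rightarrow> bool" where
  "tip_reduced Q ord X \<longleftrightarrow> (\<forall>x\<in>X. \<forall>y\<in>X. x \<noteq> 0 \<longrightarrow> y \<noteq> 0 \<longrightarrow> x \<noteq> y \<longrightarrow>
     \<not> subpath Q (tip ord x) (tip ord y))"

definition I_Mon :: "('v, 'e) pre_digraph \<Rightarrow> ('v, 'e) qpath rel \<Rightarrow>
    ('v, 'e, 'k::field) qelem set \<Rightarrow> ('v, 'e, 'k) qelem set" where
  "I_Mon Q ord I = genideal (path_algebra Q) (path_elem ` tips ord I)"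

definition generating_paths :: "('v, 'e) pre_digraph \<Rightarrow>
    ('v, 'e, 'k::field) qelem set \<Rightarrow> ('v, 'e) qpath set \<Rightarrow> bool" where
  "generating_paths Q J X \<longleftrightarrow> X \<subseteq> paths Q \<and> genideal (path_algebra Q) (path_elem ` X) = J"

definition min_tips :: "('v, 'e) pre_digraph \<Rightarrow> ('v, 'e) qpath rel \<Rightarrow>
    ('v, 'e, 'k::field) qelem set \<Rightarrow> ('v, 'e) qpath set" where
  "min_tips Q ord I = (THE X. generating_paths Q (I_Mon Q ord I) X \<and>
     (\<forall>Y. Y \<subset> X \<longrightarrow> \<not> generating_paths Q (I_Mon Q ord I) Y))"

definition reduced_elem :: "('v, 'e) pre_digraph \<Rightarrow> ('v, 'e) qpath rel \<Rightarrow>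
    ('v, 'e, 'k::field) qelem set \<Rightarrow> ('v, 'e) qpath \<Rightarrow> ('v, 'e, 'k) qelem" where
  "reduced_elem Q ord I t = (THE g. g \<in> I \<and> path_elem t - g \<in> Span (paths Q - tips ord I))"

definition reduced_groebner_basis :: "('v, 'e) pre_digraph \<Rightarrow> ('v, 'e) qpath rel \<Rightarrow>
    ('v, 'e, 'k::field) qelem set \<Rightarrow> ('v, 'e, 'k) qelem set" where
  "reduced_groebner_basis Q ord I = reduced_elem Q ord I ` min_tips Q ord I"

section \<open>Affine varieties\<close>

text \<open>
  Points of the affine space with coordinates indexed by \<open>X\<close> are finitely supported families,
  encoded as finitely supported functions vanishing outside \<open>X\<close>. In particular, for
  \<open>X \<subseteq> Y\<close> the set \<open>affine_space X\<close> is the coordinate subspace of \<open>affine_space Y\<close>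
  given by extension by zero.
\<close>

definition affine_space :: "'i set \<Rightarrow> ('i \<Rightarrow>\<^sub>0 'k::field) set" where
  "affine_space X = {c. Poly_Mapping.keys c \<subseteq> X}"

text \<open>
  A polynomial is a finitely supported function from monomials (exponent vectors) to coefficients.
\<close>

definition poly_eval :: "(('i \<Rightarrow>\<^sub>0 nat) \<Rightarrow>\<^sub>0 'k) \<Rightarrow> ('i \<Rightarrow>\<^sub>0 'k::field) \<Rightarrow> 'k" where
  "poly_eval P c = (\<Sum>m\<in>Poly_Mapping.keys P. Poly_Mapping.lookup P m *
     (\<Prod>i\<in>Poly_Mapping.keys m. Poly_Mapping.lookup c i ^ Poly_Mapping.lookup m i))"

text \<open>
  For finite \<open>X\<close> the regular functions are the polynomial functions (see below). For infinite
  \<open>X\<close> the space is the union of its finite-dimensional coordinate subspaces, and its regular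
  functions are those that are polynomial on each of these, as usual for ind-varieties. Polynomials
  in finitely many of the variables would not suffice there: the Groebner conditions can involve
  expressions such as the sum of all \<open>a k * c ^ k\<close>, which is a finite sum at every point only.
\<close>

definition regular_function :: "'i set \<Rightarrow> (('i \<Rightarrow>\<^sub>0 'k::field) \<Rightarrow> 'k) \<Rightarrow> bool" where
  "regular_function X f \<longleftrightarrow>
     (\<forall>F. finite F \<longrightarrow> F \<subseteq> X \<longrightarrow> (\<exists>P. \<forall>c\<in>affine_space F. f c = poly_eval P c))"

lemma regular_function_finite:
  assumes "finite X"
  shows "regular_function X f \<longleftrightarrow> (\<exists>P. \<forall>c\<in>affine_space X. f c = poly_eval P c)"
proof
  assume "regular_function X f"
  then show "\<exists>P. \<forall>c\<in>affine_space X. f c = poly_eval P c"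
    using assms unfolding regular_function_def by blast
next
  assume "\<exists>P. \<forall>c\<in>affine_space X. f c = poly_eval P c"
  then show "regular_function X f"
    unfolding regular_function_def affine_space_def by blast
qed

definition affine_variety :: "'i set \<Rightarrow> ('i \<Rightarrow>\<^sub>0 'k::field) set \<Rightarrow> bool" where
  "affine_variety X V \<longleftrightarrow> (\<exists>E. (\<forall>f\<in>E. regular_function X f) \<and>
     V = {c \<in> affine_space X. \<forall>f\<in>E. f c = 0})"

text \<open>
  The second conjunct is the ind-variety condition; it follows from the first one when
  \<open>Y\<close> is finite.
\<close>

definition regular_map :: "'i set \<Rightarrow> 'j set \<Rightarrow> (('i \<Rightarrow>\<^sub>0 'k::field) \<Rightarrow> ('j \<Rightarrow>\<^sub>0 'k)) \<Rightarrow> bool" where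
  "regular_map X Y f \<longleftrightarrow> f ` affine_space X \<subseteq> affine_space Y \<and>
     (\<forall>F. finite F \<longrightarrow> F \<subseteq> X \<longrightarrow>
        (\<exists>F'. finite F' \<and> F' \<subseteq> Y \<and> f ` affine_space F \<subseteq> affine_space F')) \<and>
     (\<forall>j\<in>Y. regular_function X (\<lambda>c. Poly_Mapping.lookup (f c) j))"

definition variety_iso :: "'i set \<Rightarrow> ('i \<Rightarrow>\<^sub>0 'k::field) set \<Rightarrow>
    'j set \<Rightarrow> ('j \<Rightarrow>\<^sub>0 'k) set \<Rightarrow> bool" where
  "variety_iso X V Y V' \<longleftrightarrow> (\<exists>f g. regular_map X Y f \<and> regular_map Y X g \<and>
     f ` V \<subseteq> V' \<and> g ` V' \<subseteq> V \<and> (\<forall>c\<in>V. g (f c) = c) \<and> (\<forall>c\<in>V'. f (g c) = c))"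

section \<open>The varieties attached to a set of paths\<close>

definition normal_paths :: "('v, 'e) pre_digraph \<Rightarrow> ('v, 'e) qpath set \<Rightarrow> ('v, 'e) qpath set" where
  "normal_paths Q T = {p \<in> paths Q. \<forall>t\<in>T. \<not> subpath Q t p}"

definition N_set :: "('v, 'e) pre_digraph \<Rightarrow> ('v, 'e) qpath rel \<Rightarrow> ('v, 'e) qpath set \<Rightarrow>
    ('v, 'e) qpath \<Rightarrow> ('v, 'e) qpath set" where
  "N_set Q ord T t = {n \<in> normal_paths Q T. parallel Q n t \<and> greater ord t n}"

definition weight :: "('g, 'm) monoid_scheme \<Rightarrow> ('e \<Rightarrow> 'g) \<Rightarrow> ('v, 'e) qpath \<Rightarrow> 'g" where
  "weight G W p = foldr (\<lambda>a g. W a \<otimes>\<^bsub>G\<^esub> g) (snd p) \<one>\<^bsub>G\<^esub>"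

definition NW_set :: "('v, 'e) pre_digraph \<Rightarrow> ('v, 'e) qpath rel \<Rightarrow> ('g, 'm) monoid_scheme \<Rightarrow>
    ('e \<Rightarrow> 'g) \<Rightarrow> ('v, 'e) qpath set \<Rightarrow> ('v, 'e) qpath \<Rightarrow> ('v, 'e) qpath set" where
  "NW_set Q ord G W T t = {n \<in> normal_paths Q T. parallel Q n t \<and> 1 \<le> path_length n \<and>
     greater ord t n \<and> weight G W n = weight G W t}"

text \<open>
  Below, \<open>M t\<close> is the set of paths allowed in the tail over \<open>t\<close>; it is instantiated to
  \<open>N_set\<close> and \<open>NW_set\<close>. Since \<open>T\<close> is finite, finite support for each \<open>t\<close> is the same as finite
  support of the whole family of coefficients.
\<close>

definition coeff_index :: "('v, 'e) qpath set \<Rightarrow> (('v, 'e) qpath \<Rightarrow> ('v, 'e) qpath set) \<Rightarrow>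
    (('v, 'e) qpath \<times> ('v, 'e) qpath) set" where
  "coeff_index T M = Sigma T M"

definition generators :: "('v, 'e) qpath set \<Rightarrow> (('v, 'e) qpath \<Rightarrow> ('v, 'e) qpath set) \<Rightarrow>
    (('v, 'e) qpath \<times> ('v, 'e) qpath \<Rightarrow>\<^sub>0 'k::field) \<Rightarrow> ('v, 'e, 'k) qelem set" where
  "generators T M c = (\<lambda>t. path_elem t -
     (\<Sum>n\<in>{n \<in> M t. Poly_Mapping.lookup c (t, n) \<noteq> 0}.
        Poly_Mapping.single n (Poly_Mapping.lookup c (t, n)))) ` T"

definition groebner_locus :: "('v, 'e) pre_digraph \<Rightarrow> ('v, 'e) qpath rel \<Rightarrow>
    ('v, 'e) qpath set \<Rightarrow> (('v, 'e) qpath \<Rightarrow> ('v, 'e) qpath set) \<Rightarrow>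
    (('v, 'e) qpath \<times> ('v, 'e) qpath \<Rightarrow>\<^sub>0 'k::field) set" where
  "groebner_locus Q ord T M = {c \<in> affine_space (coeff_index T M).
     generators T M c =
       reduced_groebner_basis Q ord (genideal (path_algebra Q) (generators T M c))}"

definition V_T :: "('v, 'e) pre_digraph \<Rightarrow> ('v, 'e) qpath rel \<Rightarrow> ('v, 'e) qpath set \<Rightarrow>
    (('v, 'e) qpath \<times> ('v, 'e) qpath \<Rightarrow>\<^sub>0 'k::field) set" where
  "V_T Q ord T = groebner_locus Q ord T (N_set Q ord T)"

definition V_TW :: "('v, 'e) pre_digraph \<Rightarrow> ('v, 'e) qpath rel \<Rightarrow> ('g, 'm) monoid_scheme \<Rightarrow>
    ('e \<Rightarrow> 'g) \<Rightarrow> ('v, 'e) qpath set \<Rightarrow>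
    (('v, 'e) qpath \<times> ('v, 'e) qpath \<Rightarrow>\<^sub>0 'k::field) set" where
  "V_TW Q ord G W T = groebner_locus Q ord T (NW_set Q ord G W T)"

definition V_T_phi :: "('v, 'e) pre_digraph \<Rightarrow> ('v, 'e) qpath rel \<Rightarrow> ('v, 'e) qpath set \<Rightarrow>
    (('v, 'e) qpath \<Rightarrow> ('v, 'e) qpath set) \<Rightarrow> (('v, 'e) qpath \<Rightarrow> ('v, 'e) qpath \<Rightarrow> 'k) \<Rightarrow>
    (('v, 'e) qpath \<times> ('v, 'e) qpath \<Rightarrow>\<^sub>0 'k::field) set" where
  "V_T_phi Q ord T S \<phi> =
     {c \<in> V_T Q ord T. \<forall>t\<in>T. \<forall>n\<in>S t. Poly_Mapping.lookup c (t, n) = \<phi> t n}"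

text \<open>
  \<open>V_TW\<close> lies in the coordinate subspace \<open>affine_space (coeff_index T (NW_set \<dots>))\<close> of the ambient
  space of \<open>V_T\<close>, so \<open>special_subvariety\<close> applies to it through extension by zero.
\<close>

definition special_subvariety :: "('v, 'e) pre_digraph \<Rightarrow> ('v, 'e) qpath rel \<Rightarrow>
    ('v, 'e) qpath set \<Rightarrow> (('v, 'e) qpath \<times> ('v, 'e) qpath \<Rightarrow>\<^sub>0 'k::field) set \<Rightarrow> bool" where
  "special_subvariety Q ord T U \<longleftrightarrow>
     (\<exists>S \<phi>. (\<forall>t\<in>T. S t \<subseteq> N_set Q ord T t) \<and> U = V_T_phi Q ord T S \<phi>)"

end

theory Submission
  imports Defs
begin

text \<open>
  Write \<open>g\<^sub>t(c)\<close> for the generator with tip \<open>t\<close> and coefficients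
  \<open>c\<close>, \<open>I\<^sub>c\<close> for the ideal generated by all
  \<open>g\<^sub>t(c)\<close>, and call a path normal if it has no subpath in \<open>T\<close>.
  A coefficient family supported on the pairs \<open>(t, n)\<close> with \<open>n\<close> of the
  same weight as \<open>t\<close> and of positive length defines the same generators whether it
  is read in the smaller or in the larger coefficient space. Hence, after extension by zero,
  \<open>V_TW\<close> is exactly the part of \<open>V_T\<close> on which the remaining
  coordinates vanish (\<open>groebner_locus_restrict\<close>). This makes it a special
  subvariety, and the isomorphism is the inclusion of a coordinate subspace, with the coordinate
  projection as inverse (\<open>variety_iso_coordinate_subspace\<close>).

  The substance is that such a locus is an affine variety
  (\<open>affine_variety_groebner_locus\<close>): being a reduced Groebner basis has to be
  expressed by equations that are regular in \<open>c\<close>. The first step is linear algebra.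
  Since \<open>T\<close> is an antichain for the subpath relation and the tails consist of
  smaller normal paths, the \<open>g\<^sub>t(c)\<close> form the reduced Groebner basis of
  \<open>I\<^sub>c\<close> iff \<open>I\<^sub>c\<close> contains no nonzero combination of
  normal paths (\<open>reduced_groebner_basis_iff\<close>).

  The second step tests this with normal forms. Choose for every path \<open>p\<close> that is
  not normal one factorisation \<open>p = r t s\<close> with \<open>t \<in> T\<close>; modulo
  \<open>I\<^sub>c\<close> it may be replaced by \<open>r (t - g\<^sub>t(c)) s\<close>, a
  combination of smaller paths whose coefficients are coordinates of \<open>c\<close>.
  Well-founded induction along the admissible order yields a combination
  \<open>h\<^sub>p(c)\<close> of normal paths at most \<open>p\<close>, congruent to
  \<open>p\<close> modulo \<open>I\<^sub>c\<close>, equal to \<open>p\<close> if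
  \<open>p\<close> is normal, and regular in \<open>c\<close>
  (\<open>normal_form_family\<close>). Extend \<open>h(c)\<close> linearly. It maps
  \<open>I\<^sub>c\<close> into the normal elements of \<open>I\<^sub>c\<close> and fixes normal
  elements, so there are no nonzero ones iff \<open>h(c)\<close> vanishes on
  \<open>I\<^sub>c\<close>, that is, iff it vanishes on the spanning set of all \<open>r
  g\<^sub>t(c) s\<close> (\<open>genideal_Int_Span_eq_0_iff\<close>). The coordinates of
  \<open>h(c) (r g\<^sub>t(c) s)\<close> are the required equations.
\<close>

abbreviation (input) "keys \<equiv> Poly_Mapping.keys"
abbreviation (input) "lookup \<equiv> Poly_Mapping.lookup"
abbreviation (input) "single \<equiv> Poly_Mapping.single"

section \<open>Linear maps given on a basis\<close>

definition scale :: "'k::field \<Rightarrow> ('p \<Rightarrow>\<^sub>0 'k) \<Rightarrow> ('p \<Rightarrow>\<^sub>0 'k)" where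
  "scale a x = Poly_Mapping.map ((*) a) x"

lemma lookup_scale [simp]: "lookup (scale a x) k = a * lookup x k"
  by (simp add: scale_def Poly_Mapping.map.rep_eq when_def)

lemma keys_scale_subset: "keys (scale a x) \<subseteq> keys x"
  by (auto simp: in_keys_iff)

lemma scale_one [simp]: "scale 1 x = x"
  by (rule poly_mapping_eqI) simp

lemma scale_zero [simp]: "scale 0 x = 0" "scale a 0 = 0"
  by (rule poly_mapping_eqI, simp)+

lemma scale_scale: "scale a (scale b x) = scale (a * b) x"
  by (rule poly_mapping_eqI) (simp add: algebra_simps)

lemma scale_sum: "scale a (sum f A) = (\<Sum>i\<in>A. scale a (f i))"
  by (rule poly_mapping_eqI) (simp add: lookup_sum sum_distrib_left)

lemma scale_single: "scale a (single p b) = single p (a * b)"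
  by (rule poly_mapping_eqI) (simp add: lookup_single when_def)

lemma scale_minus_one: "scale (- 1) x = - x"
  by (rule poly_mapping_eqI) simp

text \<open>
  Multiplication of the path algebra, two-sided multiples by paths, normal forms and coordinate
  projections are all linear maps prescribed on basis elements; treating them through this one
  construction makes their algebra a matter of composing and exchanging sums.
\<close>

definition linext :: "('p \<Rightarrow> ('q \<Rightarrow>\<^sub>0 'k)) \<Rightarrow> ('p \<Rightarrow>\<^sub>0 'k::field) \<Rightarrow> ('q \<Rightarrow>\<^sub>0 'k)" where
  "linext f x = (\<Sum>p\<in>keys x. scale (lookup x p) (f p))"

lemma linext_superset:
  assumes "finite A" "keys x \<subseteq> A"
  shows "linext f x = (\<Sum>p\<in>A. scale (lookup x p) (f p))"
  unfolding linext_def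
  by (rule sum.mono_neutral_left) (use assms in \<open>auto simp: not_in_keys_iff_lookup_eq_zero\<close>)

lemma lookup_linext:
  assumes "finite A" "keys x \<subseteq> A"
  shows "lookup (linext f x) k = (\<Sum>p\<in>A. lookup x p * lookup (f p) k)"
  by (simp add: linext_superset[OF assms] lookup_sum)

lemma lookup_linext_keys: "lookup (linext f x) k = (\<Sum>p\<in>keys x. lookup x p * lookup (f p) k)"
  by (rule lookup_linext) auto

lemma linext_cong: "(\<And>p. p \<in> keys x \<Longrightarrow> f p = g p) \<Longrightarrow> linext f x = linext g x"
  unfolding linext_def by (rule sum.cong) auto

lemma linext_zero [simp]: "linext f 0 = 0"
  by (simp add: linext_def)

lemma linext_zero_fun [simp]: "linext (\<lambda>_. 0) x = 0"
  by (simp add: linext_def)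

lemma linext_single [simp]: "linext f (single p a) = scale a (f p)"
  by (simp add: linext_def)

lemma linext_path_elem [simp]: "linext f (path_elem p) = f p"
  by (simp add: path_elem_def)

lemma linext_add: "linext f (x + y) = linext f x + linext f y"
proof (rule poly_mapping_eqI)
  fix k
  let ?A = "keys x \<union> keys y"
  have "lookup (linext f (x + y)) k = (\<Sum>p\<in>?A. lookup (x + y) p * lookup (f p) k)"
    by (rule lookup_linext[OF _ Poly_Mapping.keys_add]) simp
  also have "\<dots> = (\<Sum>p\<in>?A. lookup x p * lookup (f p) k) + (\<Sum>p\<in>?A. lookup y p * lookup (f p) k)"
    by (simp add: lookup_add algebra_simps sum.distrib)
  also have "\<dots> = lookup (linext f x) k + lookup (linext f y) k"
    by (simp add: lookup_linext[where A = ?A])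
  finally show "lookup (linext f (x + y)) k = lookup (linext f x + linext f y) k"
    by (simp add: lookup_add)
qed

lemma linext_scale: "linext f (scale a x) = scale a (linext f x)"
  by (rule poly_mapping_eqI)
    (simp add: lookup_linext[OF finite_keys keys_scale_subset, of f a x]
       lookup_linext_keys[of f x] sum_distrib_left mult.assoc)

lemma linext_sum: "linext f (sum g A) = (\<Sum>i\<in>A. linext f (g i))"
  by (induction A rule: infinite_finite_induct) (simp_all add: linext_add)

lemma linext_uminus: "linext f (- x) = - linext f x"
  by (metis linext_scale scale_minus_one)

lemma linext_diff: "linext f (x - y) = linext f x - linext f y"
  by (metis diff_conv_add_uminus linext_add linext_uminus)

lemma linext_add_fun: "linext (\<lambda>p. f p + g p) x = linext f x + linext g x"
  by (rule poly_mapping_eqI)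
    (simp add: lookup_linext_keys lookup_add algebra_simps sum.distrib)

lemma linext_diff_fun: "linext (\<lambda>p. f p - g p) x = linext f x - linext g x"
  by (rule poly_mapping_eqI)
    (simp add: lookup_linext_keys lookup_minus algebra_simps sum_subtractf)

lemma linext_linext: "linext f (linext g x) = linext (\<lambda>p. linext f (g p)) x"
  unfolding linext_def[of g] linext_def[of "\<lambda>p. linext f (g p)"]
  by (simp add: linext_sum linext_scale)

lemma linext_swap:
  "linext (\<lambda>q. linext (\<lambda>p. f p q) x) y = linext (\<lambda>p. linext (\<lambda>q. f p q) y) x"
  by (rule poly_mapping_eqI)
    (simp only: lookup_linext_keys sum_distrib_left, subst sum.swap, simp only: mult.left_commute)

lemma linext_path_elem_id: "linext path_elem x = x"
  by (rule poly_mapping_eqI)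
    (auto simp: lookup_linext_keys path_elem_def lookup_single when_def in_keys_iff
      if_distrib sum.delta cong: if_cong)

lemma keys_linext:
  "keys (linext f x) \<subseteq> (\<Union>p\<in>keys x. keys (f p))"
proof
  fix k assume "k \<in> keys (linext f x)"
  then have "(\<Sum>p\<in>keys x. lookup x p * lookup (f p) k) \<noteq> 0"
    by (simp add: in_keys_iff lookup_linext_keys)
  then obtain p where "p \<in> keys x" "lookup x p * lookup (f p) k \<noteq> 0"
    by (meson sum.not_neutral_contains_not_neutral)
  then show "k \<in> (\<Union>p\<in>keys x. keys (f p))"
    by (auto simp: in_keys_iff)
qed

lemma Span_add: "x \<in> Span X \<Longrightarrow> y \<in> Span X \<Longrightarrow> x + y \<in> Span X"
  using Poly_Mapping.keys_add[of x y] by (auto simp: Span_def)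

lemma Span_zero [simp]: "0 \<in> Span X"
  by (simp add: Span_def)

lemma Span_uminus: "x \<in> Span X \<Longrightarrow> - x \<in> Span X"
  by (auto simp: Span_def in_keys_iff)

lemma Span_diff: "x \<in> Span X \<Longrightarrow> y \<in> Span X \<Longrightarrow> x - y \<in> Span X"
  by (metis Span_add Span_uminus diff_conv_add_uminus)

lemma Span_scale: "x \<in> Span X \<Longrightarrow> scale a x \<in> Span X"
  using keys_scale_subset[of a x] by (auto simp: Span_def)

lemma Span_sum: "(\<And>i. i \<in> A \<Longrightarrow> f i \<in> Span X) \<Longrightarrow> sum f A \<in> Span X"
  by (induction A rule: infinite_finite_induct) (auto intro: Span_add)

lemma Span_linext:
  "(\<And>p. p \<in> keys x \<Longrightarrow> f p \<in> Span X) \<Longrightarrow> linext f x \<in> Span X"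
  using keys_linext[of f x] by (fastforce simp: Span_def)

lemma path_elem_in_Span [simp]: "(path_elem p :: ('v, 'e, 'k::field) qelem) \<in> Span X \<longleftrightarrow> p \<in> X"
  by (simp add: Span_def path_elem_def)

section \<open>Regular functions and regular maps\<close>

definition monom_eval :: "('i \<Rightarrow>\<^sub>0 nat) \<Rightarrow> ('i \<Rightarrow>\<^sub>0 'k::field) \<Rightarrow> 'k" where
  "monom_eval m c = (\<Prod>i\<in>keys m. lookup c i ^ lookup m i)"

lemma monom_eval_superset:
  assumes "finite A" "keys m \<subseteq> A"
  shows "monom_eval m c = (\<Prod>i\<in>A. lookup c i ^ lookup m i)"
  unfolding monom_eval_def
  by (rule prod.mono_neutral_left) (use assms in \<open>auto simp: not_in_keys_iff_lookup_eq_zero\<close>)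

lemma monom_eval_add: "monom_eval (m + m') c = monom_eval m c * monom_eval m' c"
proof -
  let ?A = "keys m \<union> keys m'"
  have "keys (m + m') \<subseteq> ?A"
    by (rule Poly_Mapping.keys_add)
  then show ?thesis
    by (simp add: monom_eval_superset[where A = ?A] lookup_add power_add prod.distrib)
qed

lemma poly_eval_superset:
  assumes "finite A" "keys P \<subseteq> A"
  shows "poly_eval P c = (\<Sum>m\<in>A. lookup P m * monom_eval m c)"
  unfolding poly_eval_def monom_eval_def[symmetric]
  by (rule sum.mono_neutral_left) (use assms in \<open>auto simp: not_in_keys_iff_lookup_eq_zero\<close>)

lemma poly_eval_add: "poly_eval (P + P') c = poly_eval P c + poly_eval P' c"
proof -
  let ?A = "keys P \<union> keys P'"
  have "keys (P + P') \<subseteq> ?A"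
    by (rule Poly_Mapping.keys_add)
  then show ?thesis
    by (simp add: poly_eval_superset[where A = ?A] lookup_add algebra_simps sum.distrib)
qed

lemma poly_eval_zero [simp]: "poly_eval 0 c = 0"
  by (simp add: poly_eval_def)

lemma poly_eval_sum: "poly_eval (sum f A) c = (\<Sum>i\<in>A. poly_eval (f i) c)"
  by (induction A rule: infinite_finite_induct) (simp_all add: poly_eval_add)

lemma poly_eval_single: "poly_eval (single m a) c = a * monom_eval m c"
  by (simp add: poly_eval_def monom_eval_def)

lemma poly_mapping_sum_single: "P = (\<Sum>m\<in>keys P. single m (lookup P m))"
  by (rule poly_mapping_eqI)
    (auto simp: lookup_sum lookup_single when_def in_keys_iff)

lemma poly_eval_mult: "poly_eval (P * P') c = poly_eval P c * poly_eval P' c"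
proof -
  have "P * P' = (\<Sum>m\<in>keys P. \<Sum>m'\<in>keys P'. single (m + m') (lookup P m * lookup P' m'))"
    by (subst poly_mapping_sum_single[of P], subst poly_mapping_sum_single[of P'])
      (simp add: sum_product mult_single)
  then have "poly_eval (P * P') c = (\<Sum>m\<in>keys P. \<Sum>m'\<in>keys P'.
      (lookup P m * monom_eval m c) * (lookup P' m' * monom_eval m' c))"
    by (simp add: poly_eval_sum poly_eval_single monom_eval_add algebra_simps)
  also have "\<dots> = poly_eval P c * poly_eval P' c"
    by (simp add: poly_eval_def monom_eval_def sum_product)
  finally show ?thesis .
qed

lemma affine_space_mono: "F \<subseteq> X \<Longrightarrow> affine_space F \<subseteq> affine_space X"
  by (auto simp: affine_space_def)

lemma regular_function_cong:
  assumes "\<And>c. c \<in> affine_space X \<Longrightarrow> f c = g c" "regular_function X g"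
  shows "regular_function X f"
  unfolding regular_function_def
proof (intro allI impI)
  fix F assume F: "finite F" "F \<subseteq> X"
  obtain P where "\<forall>c\<in>affine_space F. g c = poly_eval P c"
    using assms(2) F unfolding regular_function_def by blast
  then show "\<exists>P. \<forall>c\<in>affine_space F. f c = poly_eval P c"
    using assms(1) affine_space_mono[OF F(2)] by (intro exI[of _ P]) auto
qed

text \<open>
  Regularity only has to be checked on finitely many coordinates at a time. This is what allows
  sums whose finite index set depends on the chosen coordinates.
\<close>

lemma regular_function_on_finite:
  "regular_function X f \<longleftrightarrow> (\<forall>F. finite F \<longrightarrow> F \<subseteq> X \<longrightarrow> regular_function F f)"
proof (intro iffI allI impI)
  fix F assume "regular_function X f" "F \<subseteq> X"
  then show "regular_function F f"
    unfolding regular_function_def by (meson order_trans)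
next
  assume *: "\<forall>F. finite F \<longrightarrow> F \<subseteq> X \<longrightarrow> regular_function F f"
  show "regular_function X f"
    unfolding regular_function_def
  proof (intro allI impI)
    fix F assume "finite F" "F \<subseteq> X"
    with * have "regular_function F f" by blast
    with \<open>finite F\<close> show "\<exists>P. \<forall>c\<in>affine_space F. f c = poly_eval P c"
      by (simp add: regular_function_finite)
  qed
qed

lemma regular_function_const [simp]: "regular_function X (\<lambda>_. a)"
  unfolding regular_function_def
  by (intro allI impI exI[of _ "single 0 a"] ballI) (simp only: poly_eval_single, simp add: monom_eval_def)

lemma regular_function_coord [simp]: "regular_function X (\<lambda>c. lookup c i)"
  unfolding regular_function_def
  by (intro allI impI exI[of _ "single (single i 1) 1"] ballI)
    (simp only: poly_eval_single, simp add: monom_eval_def)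

lemma regular_function_add:
  assumes "regular_function X f" "regular_function X g"
  shows "regular_function X (\<lambda>c. f c + g c)"
  unfolding regular_function_def
proof (intro allI impI)
  fix F assume F: "finite F" "F \<subseteq> X"
  obtain P where "\<forall>c\<in>affine_space F. f c = poly_eval P c"
    using assms(1) F unfolding regular_function_def by metis
  moreover obtain P' where "\<forall>c\<in>affine_space F. g c = poly_eval P' c"
    using assms(2) F unfolding regular_function_def by metis
  ultimately show "\<exists>P. \<forall>c\<in>affine_space F. f c + g c = poly_eval P c"
    by (intro exI[of _ "P + P'"]) (simp add: poly_eval_add)
qed

lemma regular_function_mult:
  assumes "regular_function X f" "regular_function X g"
  shows "regular_function X (\<lambda>c. f c * g c)"
  unfolding regular_function_def
proof (intro allI impI)
  fix F assume F: "finite F" "F \<subseteq> X"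
  obtain P where "\<forall>c\<in>affine_space F. f c = poly_eval P c"
    using assms(1) F unfolding regular_function_def by metis
  moreover obtain P' where "\<forall>c\<in>affine_space F. g c = poly_eval P' c"
    using assms(2) F unfolding regular_function_def by metis
  ultimately show "\<exists>P. \<forall>c\<in>affine_space F. f c * g c = poly_eval P c"
    by (intro exI[of _ "P * P'"]) (simp add: poly_eval_mult)
qed

lemma regular_function_diff:
  assumes "regular_function X f" "regular_function X g"
  shows "regular_function X (\<lambda>c. f c - g c)"
  using regular_function_add[OF assms(1)
      regular_function_mult[OF regular_function_const[of X "-1"] assms(2)]] by simp

lemma regular_function_sum:
  "(\<And>i. i \<in> A \<Longrightarrow> regular_function X (f i)) \<Longrightarrow> regular_function X (\<lambda>c. \<Sum>i\<in>A. f i c)"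
  by (induction A rule: infinite_finite_induct) (auto intro: regular_function_add)

lemma regular_map_in: "regular_map X Y f \<Longrightarrow> c \<in> affine_space X \<Longrightarrow> f c \<in> affine_space Y"
  unfolding regular_map_def by (elim conjE subsetD) (rule imageI)

lemma regular_map_coord:
  assumes f: "regular_map X Y f"
  shows "regular_function X (\<lambda>c. lookup (f c) j)"
proof (cases "j \<in> Y")
  case False
  then have "lookup (f c) j = 0" if "c \<in> affine_space X" for c
    using regular_map_in[OF f that] by (auto simp: affine_space_def in_keys_iff)
  then show ?thesis
    by (rule regular_function_cong) auto
next
  case True
  with f show ?thesis
    unfolding regular_map_def by (elim conjE bspec)
qed

lemma regular_map_bound:
  assumes "regular_map X Y f" "finite F" "F \<subseteq> X"
  obtains K where "finite K" "K \<subseteq> Y" "\<And>c. c \<in> affine_space F \<Longrightarrow> keys (f c) \<subseteq> K"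
proof -
  have "\<forall>F. finite F \<longrightarrow> F \<subseteq> X \<longrightarrow>
      (\<exists>K. finite K \<and> K \<subseteq> Y \<and> f ` affine_space F \<subseteq> affine_space K)"
    using assms(1) unfolding regular_map_def by (elim conjE)
  from this[rule_format, OF assms(2,3)]
  obtain K where K: "finite K" "K \<subseteq> Y" "f ` affine_space F \<subseteq> affine_space K"
    by (elim exE conjE)
  show ?thesis
  proof (rule that[OF K(1,2)])
    show "keys (f c) \<subseteq> K" if "c \<in> affine_space F" for c
      using subsetD[OF K(3) imageI[OF that]] by (simp add: affine_space_def)
  qed
qed

lemma regular_mapI:
  assumes "\<And>c. c \<in> affine_space X \<Longrightarrow> keys (f c) \<subseteq> Y"
    and "\<And>F. finite F \<Longrightarrow> F \<subseteq> X \<Longrightarrow>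
      \<exists>K. finite K \<and> K \<subseteq> Y \<and> (\<forall>c\<in>affine_space F. keys (f c) \<subseteq> K)"
    and "\<And>j. regular_function X (\<lambda>c. lookup (f c) j)"
  shows "regular_map X Y f"
proof -
  have *: "f ` A \<subseteq> affine_space K \<longleftrightarrow> (\<forall>c\<in>A. keys (f c) \<subseteq> K)" for A K
    unfolding affine_space_def by auto
  show ?thesis
    unfolding regular_map_def * using assms by simp
qed

lemma regular_map_keys: "regular_map X Y f \<Longrightarrow> c \<in> affine_space X \<Longrightarrow> keys (f c) \<subseteq> Y"
  using regular_map_in[of X Y f c] by (simp add: affine_space_def)

lemma regular_map_mono:
  assumes f: "regular_map X Y f" and "Y \<subseteq> Y'"
  shows "regular_map X Y' f"
proof (rule regular_mapI)
  show "keys (f c) \<subseteq> Y'" if "c \<in> affine_space X" for c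
    using regular_map_keys[OF f that] assms(2) by (rule order_trans)
  show "\<exists>K. finite K \<and> K \<subseteq> Y' \<and> (\<forall>c\<in>affine_space F. keys (f c) \<subseteq> K)"
    if F: "finite F" "F \<subseteq> X" for F
  proof -
    obtain K where K: "finite K" "K \<subseteq> Y" "\<And>c. c \<in> affine_space F \<Longrightarrow> keys (f c) \<subseteq> K"
      using regular_map_bound[OF f F] by metis
    show ?thesis
      using K order_trans[OF K(2) assms(2)] by (intro exI[of _ K] conjI ballI)
  qed
  show "regular_function X (\<lambda>c. lookup (f c) j)" for j
    by (rule regular_map_coord[OF f])
qed

lemma regular_map_id: "regular_map X X (\<lambda>c. c)"
proof (rule regular_mapI)
  show "keys c \<subseteq> X" if "c \<in> affine_space X" for c
    using that by (simp add: affine_space_def)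
  fix F :: "'a set" assume "finite F" "F \<subseteq> X"
  then show "\<exists>K. finite K \<and> K \<subseteq> X \<and> (\<forall>c\<in>affine_space F. keys c \<subseteq> K)"
    by (intro exI[of _ F]) (simp add: affine_space_def)
qed (rule regular_function_coord)

lemma regular_map_const:
  assumes "keys a \<subseteq> Y"
  shows "regular_map X Y (\<lambda>_. a)"
proof (rule regular_mapI)
  fix F
  show "\<exists>K. finite K \<and> K \<subseteq> Y \<and> (\<forall>c\<in>affine_space F. keys a \<subseteq> K)"
    by (intro exI[of _ "keys a"] conjI ballI finite_keys order_refl assms)
qed (rule assms regular_function_const)+

lemma regular_map_diff:
  assumes f: "regular_map X Y f" and g: "regular_map X Y g"
  shows "regular_map X Y (\<lambda>c. f c - g c)"
proof (rule regular_mapI)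
  have sub: "keys (a - b) \<subseteq> K \<union> K'" if "keys a \<subseteq> K" "keys b \<subseteq> K'"
    for a b :: "'b \<Rightarrow>\<^sub>0 'c" and K K'
  proof -
    have "keys (a - b) \<subseteq> keys a \<union> keys b"
      by (auto simp: in_keys_iff lookup_minus)
    with that show ?thesis by blast
  qed
  show "keys (f c - g c) \<subseteq> Y" if "c \<in> affine_space X" for c
    using sub[OF regular_map_keys[OF f that] regular_map_keys[OF g that]] by simp
  fix F assume F: "finite F" "F \<subseteq> X"
  obtain K where K: "finite K" "K \<subseteq> Y" "\<And>c. c \<in> affine_space F \<Longrightarrow> keys (f c) \<subseteq> K"
    using regular_map_bound[OF f F] by metis
  obtain K' where K': "finite K'" "K' \<subseteq> Y" "\<And>c. c \<in> affine_space F \<Longrightarrow> keys (g c) \<subseteq> K'"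
    using regular_map_bound[OF g F] by metis
  show "\<exists>L. finite L \<and> L \<subseteq> Y \<and> (\<forall>c\<in>affine_space F. keys (f c - g c) \<subseteq> L)"
    using K(1,2) K'(1,2) sub[OF K(3) K'(3)] by (intro exI[of _ "K \<union> K'"]) simp
next
  fix j
  show "regular_function X (\<lambda>c. lookup (f c - g c) j)"
    unfolding lookup_minus
    by (rule regular_function_diff[OF regular_map_coord[OF f] regular_map_coord[OF g]])
qed

text \<open>
  The coordinates of \<open>\<Sum>\<^sub>p e(c)\<^sub>p f\<^sub>p(c)\<close> are sums of
  products of regular functions. The number of summands is unbounded on the whole space, but on
  a finite-dimensional coordinate subspace the support of \<open>e(c)\<close> stays in a fixed
  finite set, and there the sum is polynomial. Rewriting one step and then substituting normal
  forms is an instance.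
\<close>

lemma regular_map_linext:
  assumes e: "regular_map X Y e" and f: "\<And>p. p \<in> Y \<Longrightarrow> regular_map X Z (f p)"
  shows "regular_map X Z (\<lambda>c. linext (\<lambda>p. f p c) (e c))"
proof (rule regular_mapI)
  show "keys (linext (\<lambda>p. f p c) (e c)) \<subseteq> Z" if c: "c \<in> affine_space X" for c
  proof -
    have "keys (f p c) \<subseteq> Z" if "p \<in> keys (e c)" for p
      using regular_map_keys[OF f[OF subsetD[OF regular_map_keys[OF e c] that]] c] .
    then have "(\<Union>p\<in>keys (e c). keys (f p c)) \<subseteq> Z" by (rule UN_least)
    then show ?thesis by (rule order_trans[OF keys_linext])
  qed
  fix F assume F: "finite F" "F \<subseteq> X"
  obtain K where K: "finite K" "K \<subseteq> Y" "\<And>c. c \<in> affine_space F \<Longrightarrow> keys (e c) \<subseteq> K"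
    using regular_map_bound[OF e F] by metis
  have "\<exists>L. finite L \<and> L \<subseteq> Z \<and> (\<forall>c\<in>affine_space F. keys (f p c) \<subseteq> L)" if "p \<in> K" for p
    using regular_map_bound[OF f[OF subsetD[OF K(2) that]] F] by metis
  then have "\<exists>L. \<forall>p\<in>K. finite (L p) \<and> L p \<subseteq> Z \<and> (\<forall>c\<in>affine_space F. keys (f p c) \<subseteq> L p)"
    by (intro bchoice ballI)
  then obtain L where
    L: "\<forall>p\<in>K. finite (L p) \<and> L p \<subseteq> Z \<and> (\<forall>c\<in>affine_space F. keys (f p c) \<subseteq> L p)" ..
  show "\<exists>M. finite M \<and> M \<subseteq> Z \<and> (\<forall>c\<in>affine_space F. keys (linext (\<lambda>p. f p c) (e c)) \<subseteq> M)"
  proof (intro exI conjI ballI)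
    show "finite (\<Union>p\<in>K. L p)" "(\<Union>p\<in>K. L p) \<subseteq> Z"
      using K(1) L by auto
    show "keys (linext (\<lambda>p. f p c) (e c)) \<subseteq> (\<Union>p\<in>K. L p)" if c: "c \<in> affine_space F" for c
    proof -
      have "(\<Union>p\<in>keys (e c). keys (f p c)) \<subseteq> (\<Union>p\<in>K. L p)"
        by (rule UN_mono[OF K(3)[OF c]]) (use L c K(3)[OF c] in auto)
      then show ?thesis by (rule order_trans[OF keys_linext])
    qed
  qed
next
  fix j
  show "regular_function X (\<lambda>c. lookup (linext (\<lambda>p. f p c) (e c)) j)"
    unfolding regular_function_on_finite[of X]
  proof (intro allI impI)
    fix F assume F: "finite F" "F \<subseteq> X"
    obtain K where K: "finite K" "K \<subseteq> Y" "\<And>c. c \<in> affine_space F \<Longrightarrow> keys (e c) \<subseteq> K"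
      using regular_map_bound[OF e F] by metis
    have F_reg: "regular_function F h" if "regular_function X h" for h :: "('a \<Rightarrow>\<^sub>0 'c) \<Rightarrow> 'c"
      using that[unfolded regular_function_on_finite[of X]] F by simp
    have "regular_function F (\<lambda>c. \<Sum>p\<in>K. lookup (e c) p * lookup (f p c) j)"
    proof (rule regular_function_sum)
      fix p assume "p \<in> K"
      with K(2) have "p \<in> Y" by auto
      then show "regular_function F (\<lambda>c. lookup (e c) p * lookup (f p c) j)"
        by (rule regular_function_mult[OF F_reg[OF regular_map_coord[OF e]]
            F_reg[OF regular_map_coord[OF f]]])
    qed
    then show "regular_function F (\<lambda>c. lookup (linext (\<lambda>p. f p c) (e c)) j)"
    proof (rule regular_function_cong[rotated])
      fix c :: "'a \<Rightarrow>\<^sub>0 'c" assume "c \<in> affine_space F"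
      then show "lookup (linext (\<lambda>p. f p c) (e c)) j = (\<Sum>p\<in>K. lookup (e c) p * lookup (f p c) j)"
        by (rule lookup_linext[OF K(1) K(3)])
    qed
  qed
qed

section \<open>Paths and subpaths\<close>

locale quiver = fin_digraph Q for Q :: "('v, 'e) pre_digraph"
begin

lemma paths_iff: "p \<in> paths Q \<longleftrightarrow> awalk (fst p) (snd p) (terminus Q p)"
  unfolding paths_def terminus_def by (auto elim: awalkE)

lemma terminus_eqI: "awalk (fst p) (snd p) v \<Longrightarrow> terminus Q p = v"
  unfolding terminus_def by (auto elim: awalkE)

lemma fst_conc [simp]: "fst (conc p q) = fst p"
  by (simp add: conc_def)

lemma conc_assoc: "conc (conc p q) r = conc p (conc q r)"
  by (simp add: conc_def)

lemma conc_path: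
  assumes "p \<in> paths Q" "q \<in> paths Q" "composable Q p q"
  shows conc_in_paths: "conc p q \<in> paths Q" and terminus_conc: "terminus Q (conc p q) = terminus Q q"
proof -
  have "awalk (fst (conc p q)) (snd (conc p q)) (terminus Q q)"
    using assms by (auto simp: paths_iff composable_def conc_def intro: awalk_appendI)
  then show "conc p q \<in> paths Q" "terminus Q (conc p q) = terminus Q q"
    using terminus_eqI paths_iff by metis+
qed

lemma vertex_path [simp]: "v \<in> verts Q \<Longrightarrow> (v, []) \<in> paths Q"
  by (auto simp: paths_def awalk_Nil_iff)

lemma terminus_vertex [simp]: "terminus Q (v, []) = v"
  by (simp add: terminus_def)

lemma origin_in_verts: "p \<in> paths Q \<Longrightarrow> fst p \<in> verts Q"
  unfolding paths_iff by (rule awalk_hd_in_verts)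

lemma terminus_in_verts: "p \<in> paths Q \<Longrightarrow> terminus Q p \<in> verts Q"
  unfolding paths_iff by (rule awalk_last_in_verts)

lemma conc_vertex_left [simp]: "conc (fst p, []) p = p"
  by (simp add: conc_def)

lemma conc_vertex_right [simp]: "conc p (v, []) = p"
  by (simp add: conc_def)

lemma composable_conc_left [simp]:
  "p \<in> paths Q \<Longrightarrow> q \<in> paths Q \<Longrightarrow> composable Q p q \<Longrightarrow>
   composable Q (conc p q) r \<longleftrightarrow> composable Q q r"
  by (simp add: composable_def terminus_conc)

lemma composable_conc_right [simp]: "composable Q p (conc q r) \<longleftrightarrow> composable Q p q"
  by (simp add: composable_def)

lemma subpath_refl: "p \<in> paths Q \<Longrightarrow> subpath Q p p"
  unfolding subpath_def
  by (intro bexI[of _ "(fst p, [])"] bexI[of _ "(terminus Q p, [])"])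
    (auto simp: composable_def origin_in_verts terminus_in_verts)

lemma subpath_path:
  assumes "subpath Q p q" "p \<in> paths Q"
  shows "q \<in> paths Q"
  using assms unfolding subpath_def by (auto intro!: conc_in_paths)

lemma subpath_trans:
  assumes "p \<in> paths Q" and pq: "subpath Q p q" and qw: "subpath Q q w"
  shows "subpath Q p w"
proof -
  obtain r s where rs: "r \<in> paths Q" "s \<in> paths Q" "composable Q r p" "composable Q p s"
    "q = conc r (conc p s)" using pq unfolding subpath_def by blast
  obtain r' s' where rs': "r' \<in> paths Q" "s' \<in> paths Q" "composable Q r' q" "composable Q q s'"
    "w = conc r' (conc q s')" using qw unfolding subpath_def by blast
  have ps: "conc p s \<in> paths Q" using assms rs by (intro conc_in_paths)
  have 1: "composable Q r' r" using rs' rs by simp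
  have "composable Q (conc p s) s'"
    using rs'(4) rs ps by (simp add: rs(5))
  then have 2: "composable Q s s'" using rs assms(1) by simp
  show ?thesis
    unfolding subpath_def
  proof (rule bexI[of _ "conc r' r"], rule bexI[of _ "conc s s'"], intro conjI)
    show "conc r' r \<in> paths Q" "conc s s' \<in> paths Q"
      using 1 2 rs rs' by (auto intro: conc_in_paths)
    show "composable Q (conc r' r) p" "composable Q p (conc s s')"
      using 1 rs rs' by simp_all
    show "w = conc (conc r' r) (conc p (conc s s'))"
      by (simp add: rs'(5) rs(5) conc_assoc)
  qed
qed

text \<open>
  A subpath of equal length leaves only vertices to be added on either side.
\<close>

lemma subpath_length:
  assumes "subpath Q p q"
  shows "path_length p \<le> path_length q" and "path_length p = path_length q \<Longrightarrow> p = q"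
proof -
  obtain r s where rs: "composable Q r p" "q = conc r (conc p s)"
    using assms unfolding subpath_def by blast
  show "path_length p \<le> path_length q"
    by (simp add: rs(2) path_length_def conc_def)
  assume "path_length p = path_length q"
  then have "snd r = []" "snd s = []"
    by (simp_all add: rs(2) path_length_def conc_def)
  then show "p = q"
    using rs by (cases r, cases p) (auto simp: composable_def conc_def)
qed

lemma subpath_antisym: "subpath Q p q \<Longrightarrow> subpath Q q p \<Longrightarrow> p = q"
  using subpath_length[of p q] subpath_length[of q p] by simp

lemma composable_parallel:
  "parallel Q p q \<Longrightarrow> composable Q r p \<longleftrightarrow> composable Q r q"
  "parallel Q p q \<Longrightarrow> composable Q p r \<longleftrightarrow> composable Q q r"
  by (auto simp: parallel_def composable_def)

section \<open>The path algebra\<close>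

definition path_prod :: "('v, 'e) qpath \<Rightarrow> ('v, 'e) qpath \<Rightarrow> ('v, 'e, 'k::field) qelem" where
  "path_prod p q = (if composable Q p q then path_elem (conc p q) else 0)"

lemma path_mult_linext: "path_mult Q x y = linext (\<lambda>p. linext (path_prod p) y) x"
  unfolding path_mult_def linext_def scale_sum
  by (intro sum.cong refl) (simp add: path_prod_def path_elem_def scale_single scale_scale)

lemma path_mult_add_left: "path_mult Q (x + y) z = path_mult Q x z + path_mult Q y z"
  by (simp add: path_mult_linext linext_add)

lemma path_mult_add_right: "path_mult Q x (y + z) = path_mult Q x y + path_mult Q x z"
  by (simp add: path_mult_linext linext_add linext_add_fun)

lemma path_mult_scale_left: "path_mult Q (scale a x) y = scale a (path_mult Q x y)"
  by (simp add: path_mult_linext linext_scale)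

lemma path_mult_zero [simp]: "path_mult Q 0 x = 0" "path_mult Q x 0 = 0"
  by (simp_all add: path_mult_linext)

lemma path_mult_path_elem [simp]: "path_mult Q (path_elem p) (path_elem q) = path_prod p q"
  by (simp add: path_mult_linext)

lemma path_mult_path_elem_left: "path_mult Q (path_elem p) y = linext (path_prod p) y"
  by (simp add: path_mult_linext)

lemma path_mult_linext_left: "path_mult Q (linext f x) y = linext (\<lambda>p. path_mult Q (f p) y) x"
  by (simp add: path_mult_linext linext_linext)

lemma path_mult_linext_right: "path_mult Q y (linext f x) = linext (\<lambda>p. path_mult Q y (f p)) x"
  by (simp only: path_mult_linext linext_linext linext_swap[of _ x])

lemma path_prod_in_Span:
  "p \<in> paths Q \<Longrightarrow> q \<in> paths Q \<Longrightarrow> path_prod p q \<in> Span (paths Q)"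
  by (simp add: path_prod_def conc_in_paths)

lemma path_mult_in_Span:
  "x \<in> Span (paths Q) \<Longrightarrow> y \<in> Span (paths Q) \<Longrightarrow> path_mult Q x y \<in> Span (paths Q)"
  unfolding path_mult_linext
  by (intro Span_linext path_prod_in_Span) (auto simp: Span_def)

lemma path_mult_path_prod_assoc:
  assumes "p \<in> paths Q" "q \<in> paths Q" "r \<in> paths Q"
  shows "path_mult Q (path_prod p q) (path_elem r) = path_mult Q (path_elem p) (path_prod q r)"
  using assms by (auto simp: path_prod_def conc_assoc)

text \<open>
  Both sides are trilinear in basis elements, so associativity reduces to that of concatenation;
  membership in the span ensures that only actual paths are concatenated.
\<close>

lemma path_mult_assoc:
  assumes "x \<in> Span (paths Q)" "y \<in> Span (paths Q)" "z \<in> Span (paths Q)"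
  shows "path_mult Q (path_mult Q x y) z = path_mult Q x (path_mult Q y z)"
proof -
  have "path_mult Q (path_mult Q x y) z =
      linext (\<lambda>p. linext (\<lambda>q. path_mult Q (path_prod p q) (linext path_elem z)) y) x"
    by (simp only: path_mult_linext[of x y] path_mult_linext_left linext_path_elem_id)
  then have expand: "path_mult Q (path_mult Q x y) z =
      linext (\<lambda>p. linext (\<lambda>q. linext (\<lambda>r. path_mult Q (path_prod p q) (path_elem r)) z) y) x"
    by (simp only: path_mult_linext_right)
  have "path_mult Q x (path_mult Q y z) =
      linext (\<lambda>p. path_mult Q (path_elem p) (path_mult Q y z)) x"
    by (simp add: path_mult_linext[of x] path_mult_path_elem_left)
  then have expand': "path_mult Q x (path_mult Q y z) =
      linext (\<lambda>p. linext (\<lambda>q. linext (\<lambda>r. path_mult Q (path_elem p) (path_prod q r)) z) y) x"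
    by (simp only: path_mult_linext[of y z] path_mult_linext_right)
  show ?thesis
    unfolding expand expand'
    by (intro linext_cong path_mult_path_prod_assoc) (use assms in \<open>auto simp: Span_def\<close>)
qed

lemma path_one_mult:
  assumes "x \<in> Span (paths Q)"
  shows "path_mult Q (\<Sum>v\<in>verts Q. path_elem (v, [])) x = x"
    and "path_mult Q x (\<Sum>v\<in>verts Q. path_elem (v, [])) = x"
proof -
  have left: "(\<Sum>v\<in>verts Q. path_prod (v, []) p) = path_elem p"
    and right: "(\<Sum>v\<in>verts Q. path_prod p (v, [])) = path_elem p"
    if "p \<in> keys x" for p
  proof -
    have p: "p \<in> paths Q" using assms that by (auto simp: Span_def)
    have "(\<Sum>v\<in>verts Q. path_prod (v, []) p) = (\<Sum>v\<in>verts Q. if v = fst p then path_elem p else 0)"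
      by (rule sum.cong) (auto simp: path_prod_def composable_def)
    then show "(\<Sum>v\<in>verts Q. path_prod (v, []) p) = path_elem p"
      using p by (simp add: origin_in_verts sum.delta)
    have "(\<Sum>v\<in>verts Q. path_prod p (v, [])) =
        (\<Sum>v\<in>verts Q. if v = terminus Q p then path_elem p else 0)"
      by (rule sum.cong) (auto simp: path_prod_def composable_def)
    then show "(\<Sum>v\<in>verts Q. path_prod p (v, [])) = path_elem p"
      using p by (simp add: terminus_in_verts sum.delta)
  qed
  have "path_mult Q (\<Sum>v\<in>verts Q. path_elem (v, [])) (linext path_elem x) =
      linext (\<lambda>p. \<Sum>v\<in>verts Q. path_prod (v, []) p) x"
    by (simp only: path_mult_linext_right) (simp add: path_mult_linext linext_sum)
  also have "\<dots> = linext path_elem x"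
    by (rule linext_cong) (rule left)
  finally show "path_mult Q (\<Sum>v\<in>verts Q. path_elem (v, [])) x = x"
    by (simp only: linext_path_elem_id)
  have "path_mult Q (linext path_elem x) (\<Sum>v\<in>verts Q. path_elem (v, [])) =
      linext (\<lambda>p. \<Sum>v\<in>verts Q. path_prod p (v, [])) x"
    by (simp only: path_mult_linext_left) (simp add: path_mult_linext linext_sum)
  also have "\<dots> = linext path_elem x"
    by (rule linext_cong) (rule right)
  finally show "path_mult Q x (\<Sum>v\<in>verts Q. path_elem (v, [])) = x"
    by (simp only: linext_path_elem_id)
qed

lemma path_algebra_simps [simp]:
  "carrier (path_algebra Q) = Span (paths Q)" "monoid.mult (path_algebra Q) = path_mult Q"
  "zero (path_algebra Q) = 0" "add (path_algebra Q) = (+)"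
  "one (path_algebra Q) = (\<Sum>v\<in>verts Q. path_elem (v, []))"
  by (simp_all add: path_algebra_def)

lemma path_algebra_ring: "ring (path_algebra Q :: ('v, 'e, 'k::field) qelem ring)"
proof (rule ringI)
  show "abelian_group (path_algebra Q :: ('v, 'e, 'k) qelem ring)"
  proof (rule abelian_groupI)
    fix x :: "('v, 'e, 'k) qelem" assume "x \<in> carrier (path_algebra Q)"
    then show "\<exists>y\<in>carrier (path_algebra Q). y \<oplus>\<^bsub>path_algebra Q\<^esub> x = \<zero>\<^bsub>path_algebra Q\<^esub>"
      by (intro bexI[of _ "- x"]) (simp_all add: Span_uminus)
  qed (simp_all add: Span_add algebra_simps)
  show "Group.monoid (path_algebra Q :: ('v, 'e, 'k) qelem ring)"
    by (rule monoidI)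
      (auto simp: path_mult_in_Span path_mult_assoc path_one_mult intro!: Span_sum)
qed (simp_all add: path_mult_add_left path_mult_add_right)

text \<open>
  Closure under subtraction follows from closure under multiplication by \<open>- 1\<close>, so
  ideals are described without the additive inverse of the ring structure.
\<close>

lemma ideal_iff:
  "ideal I (path_algebra Q :: ('v, 'e, 'k::field) qelem ring) \<longleftrightarrow>
     I \<subseteq> Span (paths Q) \<and> 0 \<in> I \<and> (\<forall>x\<in>I. \<forall>y\<in>I. x + y \<in> I) \<and>
     (\<forall>x\<in>I. \<forall>a\<in>Span (paths Q). path_mult Q a x \<in> I \<and> path_mult Q x a \<in> I)"
  (is "_ \<longleftrightarrow> ?R")
proof
  let ?A = "path_algebra Q :: ('v, 'e, 'k) qelem ring"
  assume I: "ideal I ?A"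
  interpret ideal I ?A by (rule I)
  show ?R
    using a_subset additive_subgroup.zero_closed[OF is_additive_subgroup]
      additive_subgroup.a_closed[OF is_additive_subgroup] I_l_closed I_r_closed by auto
next
  let ?A = "path_algebra Q :: ('v, 'e, 'k) qelem ring"
  assume R: ?R
  interpret ring ?A by (rule path_algebra_ring)
  have neg: "\<ominus>\<^bsub>?A\<^esub> x = - x" if "x \<in> Span (paths Q)" for x
    by (rule minus_equality) (use that Span_uminus in auto)
  have one: "(\<Sum>v\<in>verts Q. path_elem (v, [])) \<in> Span (paths Q)"
    by (auto intro!: Span_sum)
  have minus: "- x \<in> I" if "x \<in> I" for x
  proof -
    have x: "x \<in> Span (paths Q)" using R that by auto
    have "path_mult Q (scale (- 1) (\<Sum>v\<in>verts Q. path_elem (v, []))) x \<in> I"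
      using R that Span_scale[OF one] by blast
    then show ?thesis
      by (simp only: path_mult_scale_left path_one_mult(1)[OF x]) (simp only: scale_minus_one)
  qed
  show "ideal I ?A"
  proof (rule idealI)
    show "subgroup I (add_monoid ?A)"
    proof (rule add.subgroupI)
      fix x assume "x \<in> I"
      moreover from this have "x \<in> Span (paths Q)" using R by auto
      ultimately show "\<ominus>\<^bsub>?A\<^esub> x \<in> I" using minus neg by simp
    qed (use R in auto)
  qed (use R path_algebra_ring in auto)
qed

section \<open>Two-sided ideals and monomial ideals\<close>

text \<open>
  The element \<open>r p s\<close> of the path algebra. Two-sided ideals are spanned by such
  multiples of their generators.
\<close>

definition sandwich_path :: "('v, 'e) qpath \<Rightarrow> ('v, 'e) qpath \<Rightarrow> ('v, 'e) qpath \<Rightarrow>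
    ('v, 'e, 'k::field) qelem" where
  "sandwich_path r s p =
     (if composable Q r p \<and> composable Q p s then path_elem (conc r (conc p s)) else 0)"

definition sandwich :: "('v, 'e) qpath \<Rightarrow> ('v, 'e) qpath \<Rightarrow> ('v, 'e, 'k::field) qelem \<Rightarrow>
    ('v, 'e, 'k) qelem" where
  "sandwich r s x = linext (sandwich_path r s) x"

lemma path_mult_sandwich:
  assumes "s \<in> paths Q" "x \<in> Span (paths Q)"
  shows "path_mult Q (path_elem r) (path_mult Q x (path_elem s)) = sandwich r s x"
proof -
  have "path_mult Q (path_elem r) (path_mult Q (linext path_elem x) (path_elem s)) =
      linext (\<lambda>p. path_mult Q (path_elem r) (path_prod p s)) x"
    by (simp only: path_mult_linext_left path_mult_linext_right path_mult_path_elem)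
  also have "\<dots> = sandwich r s x"
    unfolding sandwich_def
    by (rule linext_cong) (auto simp: path_prod_def sandwich_path_def)
  finally show ?thesis by (simp only: linext_path_elem_id)
qed

lemma ideal_subset:
  "ideal I (path_algebra Q :: ('v, 'e, 'k::field) qelem ring) \<Longrightarrow> I \<subseteq> Span (paths Q)"
  by (simp add: ideal_iff)

lemma ideal_scale:
  assumes I: "ideal I (path_algebra Q :: ('v, 'e, 'k::field) qelem ring)" and x: "x \<in> I"
  shows "scale a x \<in> I"
proof -
  have one: "(\<Sum>v\<in>verts Q. path_elem (v, [])) \<in> Span (paths Q)"
    by (auto intro!: Span_sum)
  have "path_mult Q (scale a (\<Sum>v\<in>verts Q. path_elem (v, []))) x \<in> I"
    using I[unfolded ideal_iff] x Span_scale[OF one] by blast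
  then show ?thesis
    using x ideal_subset[OF I] by (simp only: path_mult_scale_left path_one_mult(1) subsetD)
qed

lemma ideal_linext:
  assumes I: "ideal I (path_algebra Q :: ('v, 'e, 'k::field) qelem ring)"
    and "\<And>p. p \<in> keys x \<Longrightarrow> f p \<in> I"
  shows "linext f x \<in> I"
proof -
  have "(\<Sum>p\<in>A. scale (lookup x p) (f p)) \<in> I" if "finite A" "A \<subseteq> keys x" for A
    using that
  proof (induction A)
    case empty
    show ?case using I by (simp add: ideal_iff)
  next
    case (insert p A)
    then show ?case using I assms(2)[of p] ideal_scale[OF I] by (simp add: ideal_iff)
  qed
  then show ?thesis unfolding linext_def by simp
qed

lemma ideal_diff:
  assumes I: "ideal I (path_algebra Q :: ('v, 'e, 'k::field) qelem ring)" and "x \<in> I" "y \<in> I"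
  shows "x - y \<in> I"
proof -
  have "x + scale (- 1) y \<in> I"
    using assms ideal_scale[OF I] by (simp add: ideal_iff)
  then show ?thesis by (simp only: scale_minus_one add_uminus_conv_diff)
qed

text \<open>
  Replacing every path of an element of \<open>I\<close> by something congruent to it modulo
  \<open>I\<close> does not leave \<open>I\<close>.
\<close>

lemma ideal_linext_congruent:
  assumes I: "ideal I (path_algebra Q :: ('v, 'e, 'k::field) qelem ring)" and x: "x \<in> I"
    and h: "\<And>p. p \<in> keys x \<Longrightarrow> path_elem p - h p \<in> I"
  shows "linext h x \<in> I"
proof -
  have "linext (\<lambda>p. path_elem p - h p) x \<in> I"
    by (rule ideal_linext[OF I h])
  then have "x - linext h x \<in> I"
    by (simp add: linext_diff_fun linext_path_elem_id)
  then have "x - (x - linext h x) \<in> I"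
    by (rule ideal_diff[OF I x])
  then show ?thesis by simp
qed

lemma ideal_sandwich:
  assumes I: "ideal I (path_algebra Q :: ('v, 'e, 'k::field) qelem ring)"
    and "x \<in> I" "r \<in> paths Q" "s \<in> paths Q"
  shows "sandwich r s x \<in> I"
proof -
  have "path_mult Q (path_elem r) (path_mult Q x (path_elem s)) \<in> I"
    using assms by (simp add: ideal_iff)
  then show ?thesis
    using assms ideal_subset[OF I] by (simp add: path_mult_sandwich subsetD)
qed

text \<open>
  The kernel of a linear map is rarely an ideal, but the elements all of whose multiples
  \<open>r x s\<close> lie in the kernel form one: \<open>r (a x) s\<close> is a combination of
  the elements \<open>(r p) x s\<close> with \<open>p\<close> running through the paths of
  \<open>a\<close>, and symmetrically on the other side. A generated ideal is therefore killed
  by the map once all \<open>r g s\<close> are, for generators \<open>g\<close>.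
\<close>

lemma sandwich_kernel_ideal:
  fixes f :: "('v, 'e) qpath \<Rightarrow> ('v, 'e, 'k::field) qelem"
  shows "ideal {x \<in> Span (paths Q). \<forall>r\<in>paths Q. \<forall>s\<in>paths Q. linext f (sandwich r s x) = 0}
    (path_algebra Q)"
  (is "ideal ?J _")
proof -
  have left: "linext f (sandwich r s (path_mult Q a x)) = 0"
    if x: "x \<in> ?J" and a: "a \<in> Span (paths Q)" and r: "r \<in> paths Q" and s: "s \<in> paths Q"
    for x a r s
  proof -
    have xs: "x \<in> Span (paths Q)" using x by simp
    have es: "path_elem s \<in> Span (paths Q)" using s by simp
    have er: "path_elem r \<in> Span (paths Q)" using r by simp
    have "sandwich r s (path_mult Q a x) =
        path_mult Q (path_elem r) (path_mult Q (path_mult Q a x) (path_elem s))"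
      by (rule path_mult_sandwich[OF s path_mult_in_Span[OF a xs], symmetric])
    also have "\<dots> = path_mult Q (path_mult Q (path_elem r) a) (path_mult Q x (path_elem s))"
      by (simp only: path_mult_assoc[OF a xs es] path_mult_assoc[OF er a path_mult_in_Span[OF xs es]])
    also have "\<dots> = linext (\<lambda>p. path_mult Q (path_prod r p) (path_mult Q x (path_elem s))) a"
      by (simp only: path_mult_path_elem_left path_mult_linext_left)
    finally have eq: "linext f (sandwich r s (path_mult Q a x)) =
        linext (\<lambda>p. linext f (path_mult Q (path_prod r p) (path_mult Q x (path_elem s)))) a"
      by (simp only: linext_linext)
    have "linext f (path_mult Q (path_prod r p) (path_mult Q x (path_elem s))) = 0"
      if "p \<in> keys a" for p
    proof (cases "composable Q r p")
      case True
      have "p \<in> paths Q" using that a by (auto simp: Span_def)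
      then have "conc r p \<in> paths Q" using r True by (intro conc_in_paths)
      then show ?thesis
        using x True s xs by (simp add: path_prod_def path_mult_sandwich)
    qed (simp add: path_prod_def)
    then have "linext f (sandwich r s (path_mult Q a x)) = linext (\<lambda>_. 0) a"
      unfolding eq by (rule linext_cong)
    then show ?thesis by simp
  qed
  have right: "linext f (sandwich r s (path_mult Q x a)) = 0"
    if x: "x \<in> ?J" and a: "a \<in> Span (paths Q)" and r: "r \<in> paths Q" and s: "s \<in> paths Q"
    for x a r s
  proof -
    have xs: "x \<in> Span (paths Q)" using x by simp
    have es: "path_elem s \<in> Span (paths Q)" using s by simp
    have "sandwich r s (path_mult Q x a) =
        path_mult Q (path_elem r) (path_mult Q (path_mult Q x a) (path_elem s))"
      by (rule path_mult_sandwich[OF s path_mult_in_Span[OF xs a], symmetric])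
    also have "\<dots> = path_mult Q (path_elem r) (path_mult Q x (path_mult Q a (path_elem s)))"
      by (simp only: path_mult_assoc[OF xs a es])
    also have "path_mult Q a (path_elem s) = linext (\<lambda>p. path_prod p s) a"
      by (simp add: path_mult_linext)
    finally have eq: "linext f (sandwich r s (path_mult Q x a)) =
        linext (\<lambda>p. linext f (path_mult Q (path_elem r) (path_mult Q x (path_prod p s)))) a"
      by (simp only: path_mult_linext_right linext_linext)
    have "linext f (path_mult Q (path_elem r) (path_mult Q x (path_prod p s))) = 0"
      if "p \<in> keys a" for p
    proof (cases "composable Q p s")
      case True
      have "p \<in> paths Q" using that a by (auto simp: Span_def)
      then have "conc p s \<in> paths Q" using s True by (intro conc_in_paths)
      then show ?thesis
        using x True r xs by (simp add: path_prod_def path_mult_sandwich)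
    qed (simp add: path_prod_def)
    then have "linext f (sandwich r s (path_mult Q x a)) = linext (\<lambda>_. 0) a"
      unfolding eq by (rule linext_cong)
    then show ?thesis by simp
  qed
  show ?thesis
    unfolding ideal_iff
  proof (intro conjI ballI)
    fix x y assume "x \<in> ?J" "y \<in> ?J"
    then show "x + y \<in> ?J" by (simp add: Span_add sandwich_def linext_add)
  next
    fix x a :: "('v, 'e, 'k) qelem" assume x: "x \<in> ?J" and a: "a \<in> Span (paths Q)"
    then have xs: "x \<in> Span (paths Q)" by simp
    show "path_mult Q a x \<in> ?J" "path_mult Q x a \<in> ?J"
      using left[OF x a] right[OF x a] path_mult_in_Span[OF a xs] path_mult_in_Span[OF xs a]
      by blast+
  qed (auto simp: sandwich_def)
qed

lemma path_mult_sum: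
  "path_mult Q (sum g A) y = (\<Sum>i\<in>A. path_mult Q (g i) y)"
  "path_mult Q y (sum g A) = (\<Sum>i\<in>A. path_mult Q y (g i))"
  by (induction A rule: infinite_finite_induct)
    (simp_all add: path_mult_add_left path_mult_add_right)

text \<open>
  Taking vertices for \<open>r\<close> and \<open>s\<close> recovers the element itself, since
  \<open>x = 1 x 1\<close> is the sum of all \<open>u x v\<close>.
\<close>

lemma linext_eq_0_if_sandwich:
  fixes x :: "('v, 'e, 'k::field) qelem"
  assumes x: "x \<in> Span (paths Q)"
    and zero: "\<And>r s. r \<in> paths Q \<Longrightarrow> s \<in> paths Q \<Longrightarrow> linext f (sandwich r s x) = 0"
  shows "linext f x = 0"
proof -
  let ?one = "\<Sum>v\<in>verts Q. path_elem (v, []) :: ('v, 'e, 'k) qelem"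
  have "x = path_mult Q ?one (path_mult Q x ?one)"
    using x by (simp add: path_one_mult)
  also have "\<dots> = (\<Sum>v\<in>verts Q. \<Sum>u\<in>verts Q.
      path_mult Q (path_elem (u, [])) (path_mult Q x (path_elem (v, []))))"
    by (simp only: path_mult_sum)
  also have "\<dots> = (\<Sum>v\<in>verts Q. \<Sum>u\<in>verts Q. sandwich (u, []) (v, []) x)"
    using x by (intro sum.cong refl path_mult_sandwich) auto
  finally have "linext f x = (\<Sum>v\<in>verts Q. \<Sum>u\<in>verts Q. linext f (sandwich (u, []) (v, []) x))"
    by (metis (no_types, lifting) linext_sum sum.cong)
  then show ?thesis
    by (simp add: zero)
qed

text \<open>
  The paths lying in the monomial ideal generated by \<open>X\<close>; by
  \<open>genideal_path_elems\<close> below they are a basis of that ideal.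
\<close>

definition upper :: "('v, 'e) qpath set \<Rightarrow> ('v, 'e) qpath set" where
  "upper X = {p \<in> paths Q. \<exists>x\<in>X. subpath Q x p}"

lemma subpath_conc:
  assumes "p \<in> paths Q" "q \<in> paths Q" "composable Q p q"
  shows "subpath Q p (conc p q)" "subpath Q q (conc p q)"
proof -
  have "conc p q = conc (fst p, []) (conc p q)" "composable Q (fst p, []) p"
    by (simp_all add: conc_def composable_def)
  then show "subpath Q p (conc p q)"
    unfolding subpath_def using assms origin_in_verts[of p] vertex_path by blast
  have "conc p q = conc p (conc q (terminus Q q, []))" "composable Q q (terminus Q q, [])"
    by (simp_all add: composable_def)
  then show "subpath Q q (conc p q)"
    unfolding subpath_def using assms terminus_in_verts[of q] vertex_path by blast
qed

lemma Span_upper_ideal: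
  assumes "X \<subseteq> paths Q"
  shows "ideal (Span (upper X)) (path_algebra Q :: ('v, 'e, 'k::field) qelem ring)"
  unfolding ideal_iff
proof (intro conjI ballI)
  fix x a :: "('v, 'e, 'k) qelem"
  assume x: "x \<in> Span (upper X)" and a: "a \<in> Span (paths Q)"
  have up: "path_prod p q \<in> Span (upper X)" "path_prod q p \<in> Span (upper X)"
    if pq: "p \<in> paths Q" "q \<in> upper X" for p q
  proof -
    obtain u where u: "u \<in> X" "subpath Q u q" "q \<in> paths Q"
      using pq(2) by (auto simp: upper_def)
    have "conc p q \<in> upper X" if "composable Q p q"
      using that u pq(1) assms subpath_conc(2)[of p q] subpath_trans[of u q] conc_in_paths
      unfolding upper_def by blast
    moreover have "conc q p \<in> upper X" if "composable Q q p"
      using that u pq(1) assms subpath_conc(1)[of q p] subpath_trans[of u q] conc_in_paths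
      unfolding upper_def by blast
    ultimately show "path_prod p q \<in> Span (upper X)" "path_prod q p \<in> Span (upper X)"
      by (simp_all add: path_prod_def)
  qed
  have xk: "p \<in> upper X" if "p \<in> keys x" for p using x that unfolding Span_def by blast
  have ak: "p \<in> paths Q" if "p \<in> keys a" for p using a that unfolding Span_def by blast
  show "path_mult Q a x \<in> Span (upper X)" "path_mult Q x a \<in> Span (upper X)"
    unfolding path_mult_linext by (intro Span_linext up xk ak; assumption)+
qed (auto simp: upper_def Span_def dest: subsetD[OF Poly_Mapping.keys_add])

lemma genideal_path_elems:
  assumes X: "X \<subseteq> paths Q"
  shows "genideal (path_algebra Q :: ('v, 'e, 'k::field) qelem ring) (path_elem ` X) = Span (upper X)"
    (is "genideal ?A ?X = _")
proof
  interpret ring ?A by (rule path_algebra_ring)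
  have sub: "?X \<subseteq> carrier ?A" using X by auto
  note I = genideal_ideal[OF sub]
  show "genideal ?A ?X \<subseteq> Span (upper X)"
    by (rule genideal_minimal[OF Span_upper_ideal[OF X]])
      (use X subpath_refl in \<open>fastforce simp: upper_def\<close>)
  show "Span (upper X) \<subseteq> genideal ?A ?X"
  proof
    fix x :: "('v, 'e, 'k) qelem" assume x: "x \<in> Span (upper X)"
    have "path_elem p \<in> genideal ?A ?X" if p: "p \<in> keys x" for p
    proof -
      obtain u r s where u: "u \<in> X" and rs: "r \<in> paths Q" "s \<in> paths Q"
        "composable Q r u" "composable Q u s" "p = conc r (conc u s)"
        using x p by (auto simp: Span_def upper_def subpath_def)
      have "sandwich r s (path_elem u) \<in> genideal ?A ?X"
        using genideal_self[OF sub] u rs by (intro ideal_sandwich[OF I]) auto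
      then show ?thesis using rs by (simp add: sandwich_def sandwich_path_def)
    qed
    then have "linext path_elem x \<in> genideal ?A ?X" by (rule ideal_linext[OF I])
    then show "x \<in> genideal ?A ?X" by (simp only: linext_path_elem_id)
  qed
qed

end

section \<open>Tips\<close>

locale ordered_quiver = quiver Q for Q :: "('v, 'e) pre_digraph" +
  fixes ord :: "('v, 'e) qpath rel"
  assumes admissible: "admissible_order Q ord"
begin

lemma ord_refl: "p \<in> paths Q \<Longrightarrow> (p, p) \<in> ord"
  using admissible unfolding admissible_order_def order_on_defs refl_on_def by blast

lemma ord_trans: "(p, q) \<in> ord \<Longrightarrow> (q, r) \<in> ord \<Longrightarrow> (p, r) \<in> ord"
  using admissible unfolding admissible_order_def order_on_defs trans_def by blast

lemma ord_antisym: "(p, q) \<in> ord \<Longrightarrow> (q, p) \<in> ord \<Longrightarrow> p = q"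
  using admissible unfolding admissible_order_def order_on_defs antisym_def by blast

lemma ord_total: "p \<in> paths Q \<Longrightarrow> q \<in> paths Q \<Longrightarrow> (p, q) \<in> ord \<or> (q, p) \<in> ord"
  using admissible ord_refl unfolding admissible_order_def order_on_defs total_on_def by metis

lemma ord_paths: "(p, q) \<in> ord \<Longrightarrow> p \<in> paths Q \<and> q \<in> paths Q"
  using admissible unfolding admissible_order_def order_on_defs by blast

lemma ord_wf: "wf (ord - Id)"
  using admissible unfolding admissible_order_def well_order_on_def by blast

text \<open>
  The two one-sided compatibility conditions of an admissible order combined.
\<close>

lemma greater_sandwich:
  assumes pq: "greater ord p q" and rs: "r \<in> paths Q" "s \<in> paths Q"
    and p: "composable Q r p" "composable Q p s" and q: "composable Q r q" "composable Q q s"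
  shows "greater ord (conc r (conc p s)) (conc r (conc q s))"
proof -
  have P: "p \<in> paths Q" "q \<in> paths Q"
    using pq ord_paths unfolding greater_def by blast+
  have right: "\<forall>p\<in>paths Q. \<forall>q\<in>paths Q. \<forall>r\<in>paths Q. greater ord p q \<longrightarrow>
      composable Q p r \<longrightarrow> composable Q q r \<longrightarrow> greater ord (conc p r) (conc q r)"
    and left: "\<forall>p\<in>paths Q. \<forall>q\<in>paths Q. \<forall>s\<in>paths Q. greater ord p q \<longrightarrow>
      composable Q s p \<longrightarrow> composable Q s q \<longrightarrow> greater ord (conc s p) (conc s q)"
    using admissible unfolding admissible_order_def by simp_all
  have "greater ord (conc p s) (conc q s)"
    by (rule right[rule_format, OF P rs(2) pq p(2) q(2)])
  moreover have "conc p s \<in> paths Q" "conc q s \<in> paths Q"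
    using P rs p q by (auto intro: conc_in_paths)
  ultimately show ?thesis
    using left[rule_format, of "conc p s" "conc q s" r] rs p q by simp
qed

lemma finite_paths_max:
  assumes "finite A" "A \<noteq> {}" "A \<subseteq> paths Q"
  shows "\<exists>p\<in>A. \<forall>q\<in>A. (q, p) \<in> ord"
  using assms
proof (induction A rule: finite_ne_induct)
  case (singleton x)
  then show ?case using ord_refl by auto
next
  case (insert x A)
  then obtain p where p: "p \<in> A" "\<forall>q\<in>A. (q, p) \<in> ord" by auto
  show ?case
  proof (cases "(x, p) \<in> ord")
    case True
    then show ?thesis using p by blast
  next
    case False
    then have "(p, x) \<in> ord" using ord_total p insert.prems by blast
    then have "\<forall>q\<in>A. (q, x) \<in> ord" using p ord_trans by blast
    then show ?thesis using ord_refl insert.prems by blast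
  qed
qed

lemma tip_eqI:
  assumes "p \<in> keys x" "\<And>q. q \<in> keys x \<Longrightarrow> (q, p) \<in> ord"
  shows "tip ord x = p"
  unfolding tip_def
  by (rule the_equality) (use assms ord_antisym in blast)+

lemma tip_greatest:
  assumes "x \<in> Span (paths Q)" "x \<noteq> 0"
  shows "tip ord x \<in> keys x" "\<And>q. q \<in> keys x \<Longrightarrow> (q, tip ord x) \<in> ord"
proof -
  have "keys x \<noteq> {}" using assms(2) by (simp add: poly_mapping_eq_iff fun_eq_iff keys.rep_eq)
  then obtain p where p: "p \<in> keys x" "\<And>q. q \<in> keys x \<Longrightarrow> (q, p) \<in> ord"
    using finite_paths_max[of "keys x"] assms(1) by (auto simp: Span_def)
  then have "tip ord x = p" by (rule tip_eqI)
  with p show "tip ord x \<in> keys x" "\<And>q. q \<in> keys x \<Longrightarrow> (q, tip ord x) \<in> ord" by auto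
qed

lemma tip_in_paths: "x \<in> Span (paths Q) \<Longrightarrow> x \<noteq> 0 \<Longrightarrow> tip ord x \<in> paths Q"
  using tip_greatest(1) by (auto simp: Span_def)

text \<open>
  Elements of this shape are the generators \<open>g\<^sub>t\<close>: a path minus a combination
  of smaller ones.
\<close>

lemma tip_path_elem_diff:
  assumes p: "p \<in> paths Q" and e: "e \<in> Span {q. greater ord p q}"
  shows "tip ord (path_elem p - e) = p" "path_elem p - e \<noteq> 0" "path_elem p - e \<in> Span (paths Q)"
proof -
  have key: "p \<in> keys (path_elem p - e)"
  proof -
    have "p \<notin> keys e" using e by (auto simp: Span_def greater_def)
    then show ?thesis by (simp add: in_keys_iff lookup_minus path_elem_def)
  qed
  have sub: "(q, p) \<in> ord" if "q \<in> keys (path_elem p - e)" for q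
  proof (cases "q = p")
    case False
    then have "q \<in> keys e"
      using that by (simp add: in_keys_iff lookup_minus path_elem_def lookup_single_not_eq)
    then show ?thesis using e by (auto simp: Span_def greater_def)
  qed (simp add: ord_refl[OF p])
  show "tip ord (path_elem p - e) = p" by (rule tip_eqI[OF key sub])
  show "path_elem p - e \<noteq> 0" using key by auto
  show "path_elem p - e \<in> Span (paths Q)" using sub ord_paths unfolding Span_def by blast
qed

lemma tip_path_elem [simp]: "p \<in> paths Q \<Longrightarrow> tip ord (path_elem p :: ('v, 'e, 'k::field) qelem) = p"
  using tip_path_elem_diff(1)[of p "0 :: ('v, 'e, 'k) qelem"] by simp

lemma tips_subset: "I \<subseteq> Span (paths Q) \<Longrightarrow> tips ord I \<subseteq> paths Q"
  unfolding tips_def using tip_in_paths by blast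

lemma tipsI: "x \<in> I \<Longrightarrow> x \<noteq> 0 \<Longrightarrow> tip ord x \<in> tips ord I"
  unfolding tips_def by blast

section \<open>Minimal generators of the ideal of tips\<close>

text \<open>
  Multiplication by \<open>r\<close> on the left and \<open>s\<close> on the right preserves the
  strict order among the paths that it does not annihilate, so the tip of \<open>r x s\<close>
  is \<open>r (tip x) s\<close> whenever this is nonzero.
\<close>

lemma tips_upper:
  assumes I: "ideal I (path_algebra Q :: ('v, 'e, 'k::field) qelem ring)"
  shows "upper (tips ord I) = tips ord I"
proof
  show "tips ord I \<subseteq> upper (tips ord I)"
    using tips_subset[OF ideal_subset[OF I]] subpath_refl unfolding upper_def by blast
  show "upper (tips ord I) \<subseteq> tips ord I"
  proof
    fix q assume "q \<in> upper (tips ord I)"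
    then obtain x where x: "x \<in> I" "x \<noteq> 0" and sub: "subpath Q (tip ord x) q"
      unfolding upper_def tips_def by blast
    define p where "p = tip ord x"
    have xs: "x \<in> Span (paths Q)" using x ideal_subset[OF I] by blast
    have pk: "p \<in> keys x" and max: "\<And>k. k \<in> keys x \<Longrightarrow> (k, p) \<in> ord"
      using tip_greatest[OF xs x(2)] by (simp_all add: p_def)
    obtain r s where rs: "r \<in> paths Q" "s \<in> paths Q" "composable Q r p" "composable Q p s"
      and q: "q = conc r (conc p s)"
      using sub unfolding subpath_def p_def by blast
    let ?y = "sandwich r s x"
    have qk: "q \<in> paths Q"
      using subpath_path sub pk xs unfolding p_def Span_def by blast
    have less: "greater ord q (conc r (conc k s))"
      if "k \<in> keys x" "k \<noteq> p" "composable Q r k" "composable Q k s" for k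
      unfolding q by (rule greater_sandwich) (use that rs max in \<open>auto simp: greater_def\<close>)
    have "lookup ?y q = (\<Sum>k\<in>keys x. if k = p then lookup x p else 0)"
      unfolding sandwich_def lookup_linext_keys
    proof (rule sum.cong[OF refl])
      fix k assume k: "k \<in> keys x"
      show "lookup x k * lookup (sandwich_path r s k) q = (if k = p then lookup x p else 0)"
        using less[OF k] rs
        by (auto simp: sandwich_path_def path_elem_def lookup_single when_def q greater_def)
    qed
    then have "q \<in> keys ?y"
      using pk by (simp add: in_keys_iff)
    moreover have "(k, q) \<in> ord" if k: "k \<in> keys ?y" for k
    proof -
      obtain k' where k': "k' \<in> keys x" "k \<in> keys (sandwich_path r s k' :: ('v, 'e, 'k) qelem)"
        using keys_linext[of "sandwich_path r s" x] k unfolding sandwich_def by blast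
      then have "composable Q r k'" "composable Q k' s" "k = conc r (conc k' s)"
        by (auto simp: sandwich_path_def path_elem_def split: if_splits)
      then show ?thesis
        using less[OF k'(1)] ord_refl[OF qk] q by (cases "k' = p") (auto simp: greater_def)
    qed
    ultimately have "tip ord ?y = q" "?y \<noteq> 0" by (auto intro: tip_eqI)
    then show "q \<in> tips ord I"
      using tipsI[OF ideal_sandwich[OF I x(1) rs(1,2)]] by simp
  qed
qed

definition minimal_paths :: "('v, 'e) qpath set \<Rightarrow> ('v, 'e) qpath set" where
  "minimal_paths U = {t \<in> U. \<forall>u\<in>U. subpath Q u t \<longrightarrow> u = t}"

text \<open>
  Passing to a proper subpath decreases the length, so every path has a minimal subpath in
  \<open>U\<close>.
\<close>

lemma upper_minimal_paths:
  assumes U: "U \<subseteq> paths Q" "upper U = U"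
  shows "upper (minimal_paths U) = U"
proof
  show "upper (minimal_paths U) \<subseteq> U"
    using U(2) unfolding upper_def minimal_paths_def by blast
  show "U \<subseteq> upper (minimal_paths U)"
  proof
    fix p assume "p \<in> U"
    then show "p \<in> upper (minimal_paths U)"
    proof (induction "path_length p" arbitrary: p rule: less_induct)
      case less
      show ?case
      proof (cases "p \<in> minimal_paths U")
        case True
        then show ?thesis using less.prems U(1) subpath_refl unfolding upper_def by blast
      next
        case False
        then obtain u where u: "u \<in> U" "subpath Q u p" "u \<noteq> p"
          using less.prems unfolding minimal_paths_def by blast
        then have "path_length u < path_length p"
          using subpath_length[OF u(2)] by (meson le_neq_implies_less)
        then obtain m where m: "m \<in> minimal_paths U" "subpath Q m u"
          using less.hyps[of u] u(1) unfolding upper_def by blast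
        then have "subpath Q m p"
          using subpath_trans[OF _ m(2) u(2)] U(1) unfolding minimal_paths_def by blast
        then show ?thesis using m(1) less.prems U(1) unfolding upper_def by blast
      qed
    qed
  qed
qed

lemma Span_eq_iff: "Span A = (Span B :: ('v, 'e, 'k::field) qelem set) \<longleftrightarrow> A = B"
proof
  assume *: "Span A = (Span B :: ('v, 'e, 'k) qelem set)"
  have "p \<in> A \<longleftrightarrow> p \<in> B" for p
    using path_elem_in_Span[where ?'k = 'k, of p A] path_elem_in_Span[where ?'k = 'k, of p B]
    unfolding * by simp
  then show "A = B" by blast
qed simp

text \<open>
  A set \<open>Y\<close> of paths generates the monomial ideal with basis \<open>U\<close> iff
  \<open>upper Y = U\<close>. Each minimal path \<open>t\<close> of \<open>U\<close> then has a
  subpath in \<open>Y\<close>, which lies in \<open>U\<close> and hence is \<open>t\<close>. So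
  the minimal paths form the least generating set, which is in particular the only minimal one.
\<close>

lemma min_tips_eq:
  assumes I: "ideal I (path_algebra Q :: ('v, 'e, 'k::field) qelem ring)"
  shows "min_tips Q ord I = minimal_paths (tips ord I)"
proof -
  let ?U = "tips ord I" and ?M = "minimal_paths (tips ord I)"
  have U: "?U \<subseteq> paths Q" "upper ?U = ?U"
    using tips_subset[OF ideal_subset[OF I]] tips_upper[OF I] .
  have gen: "generating_paths Q (I_Mon Q ord I) Y \<longleftrightarrow> Y \<subseteq> paths Q \<and> upper Y = ?U" for Y
    unfolding generating_paths_def I_Mon_def
    using U genideal_path_elems[where ?'k = 'k] by (auto simp: Span_eq_iff)
  have M_gen: "?M \<subseteq> paths Q \<and> upper ?M = ?U"
    using U upper_minimal_paths by (auto simp: minimal_paths_def)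
  have M_least: "?M \<subseteq> Y" if "Y \<subseteq> paths Q" "upper Y = ?U" for Y
  proof
    fix t assume t: "t \<in> ?M"
    then have "t \<in> upper Y" using that by (simp add: minimal_paths_def)
    then obtain y where y: "y \<in> Y" "subpath Q y t" unfolding upper_def by blast
    then have "y \<in> upper Y" using that(1) subpath_refl unfolding upper_def by blast
    then have "y = t" using t y(2) unfolding that(2) minimal_paths_def by blast
    then show "t \<in> Y" using y by simp
  qed
  show ?thesis
    unfolding min_tips_def gen
  proof (rule the_equality)
    show "(?M \<subseteq> paths Q \<and> upper ?M = ?U) \<and>
        (\<forall>Y. Y \<subset> ?M \<longrightarrow> \<not> (Y \<subseteq> paths Q \<and> upper Y = ?U))"
      using M_gen M_least by blast
    fix X assume "(X \<subseteq> paths Q \<and> upper X = ?U) \<and>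
        (\<forall>Y. Y \<subset> X \<longrightarrow> \<not> (Y \<subseteq> paths Q \<and> upper Y = ?U))"
    then show "X = ?M" using M_gen M_least by blast
  qed
qed

section \<open>Normal forms modulo an ideal\<close>

text \<open>
  Reduction to normal form, carried out for a whole family of ideals \<open>L c\<close> at once
  so that the result is regular in the parameter. Here \<open>N\<close> is the set of paths
  declared normal, and for every other path one rewriting step is given. Its outcome involves
  smaller paths only, whose normal forms are available by well-founded induction along the order
  and can be substituted linearly.
\<close>

lemma normal_form_family:
  fixes L :: "('i \<Rightarrow>\<^sub>0 'k::field) \<Rightarrow> ('v, 'e, 'k) qelem set"
  assumes L: "\<And>c. c \<in> affine_space X \<Longrightarrow> ideal (L c) (path_algebra Q)"
    and N: "N \<subseteq> paths Q"
    and step: "\<And>p. p \<in> paths Q - N \<Longrightarrow> \<exists>e. regular_map X {q. greater ord p q} e \<and>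
      (\<forall>c\<in>affine_space X. path_elem p - e c \<in> L c)"
  shows "\<exists>h. \<forall>p\<in>paths Q. regular_map X {q \<in> N. (q, p) \<in> ord} (h p) \<and>
      (\<forall>c\<in>affine_space X. path_elem p - h p c \<in> L c) \<and>
      (p \<in> N \<longrightarrow> h p = (\<lambda>_. path_elem p))"
proof -
  let ?P = "\<lambda>p f. regular_map X {q \<in> N. (q, p) \<in> ord} f \<and>
      (\<forall>c\<in>affine_space X. path_elem p - f c \<in> L c) \<and> (p \<in> N \<longrightarrow> f = (\<lambda>_. path_elem p))"
  have "\<exists>f. ?P p f" if "p \<in> paths Q" for p
    using ord_wf that
  proof (induction p rule: wf_induct_rule)
    case (less p)
    show ?case
    proof (cases "p \<in> N")
      case True
      have "regular_map X {q \<in> N. (q, p) \<in> ord} (\<lambda>_. path_elem p :: ('v, 'e, 'k) qelem)"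
        by (rule regular_map_const) (use True less.prems ord_refl in \<open>auto simp: path_elem_def\<close>)
      moreover have "\<forall>c\<in>affine_space X. path_elem p - path_elem p \<in> L c"
        using L by (simp add: ideal_iff)
      ultimately show ?thesis by (intro exI[of _ "\<lambda>_. path_elem p"]) simp
    next
      case False
      then obtain e where e: "regular_map X {q. greater ord p q} e"
        and eL: "\<And>c. c \<in> affine_space X \<Longrightarrow> path_elem p - e c \<in> L c"
        using step[of p] less.prems by blast
      have "\<exists>f. ?P q f" if "q \<in> {q. greater ord p q}" for q
      proof (rule less.IH)
        show "(q, p) \<in> ord - Id" "q \<in> paths Q"
          using that ord_paths[of q p] unfolding greater_def by auto
      qed
      then have "\<exists>f. \<forall>q\<in>{q. greater ord p q}. ?P q (f q)"
        by (intro bchoice ballI)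
      then obtain f where f: "\<forall>q\<in>{q. greater ord p q}. ?P q (f q)" ..
      have reg: "regular_map X {q \<in> N. (q, p) \<in> ord} (\<lambda>c. linext (\<lambda>q. f q c) (e c))"
      proof (rule regular_map_linext[OF e])
        fix q assume q: "q \<in> {q. greater ord p q}"
        then have "{r \<in> N. (r, q) \<in> ord} \<subseteq> {r \<in> N. (r, p) \<in> ord}"
          using ord_trans unfolding greater_def by blast
        with f q show "regular_map X {r \<in> N. (r, p) \<in> ord} (f q)"
          using regular_map_mono by (metis (no_types, lifting))
      qed
      (* The difference telescopes: from p to e(c) by the given step, then path by path inside
         e(c). *)
      have "path_elem p - linext (\<lambda>q. f q c) (e c) \<in> L c" if c: "c \<in> affine_space X" for c
      proof -
        have "linext (\<lambda>q. path_elem q - f q c) (e c) \<in> L c"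
        proof (rule ideal_linext[OF L[OF c]])
          fix q assume "q \<in> keys (e c)"
          then have "q \<in> {q. greater ord p q}" using regular_map_keys[OF e c] by blast
          with f c show "path_elem q - f q c \<in> L c" by blast
        qed
        then have "(path_elem p - e c) + linext (\<lambda>q. path_elem q - f q c) (e c) \<in> L c"
          using L[OF c] eL[OF c] unfolding ideal_iff by blast
        then show ?thesis by (simp add: linext_diff_fun linext_path_elem_id)
      qed
      with reg False show ?thesis by (intro exI[of _ "\<lambda>c. linext (\<lambda>q. f q c) (e c)"]) simp
    qed
  qed
  then show ?thesis by (intro bchoice ballI)
qed

text \<open>
  For a single ideal the parameter space is taken to be a point, the affine space without
  coordinates. A tip \<open>p\<close> is rewritten by an element of \<open>I\<close> with tip
  \<open>p\<close>, normalised to leading coefficient \<open>1\<close>.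
\<close>

lemma ideal_normal_form:
  fixes I :: "('v, 'e, 'k::field) qelem set"
  assumes I: "ideal I (path_algebra Q)" and p: "p \<in> paths Q"
  shows "\<exists>h\<in>Span (paths Q - tips ord I). path_elem p - h \<in> I"
proof -
  let ?N = "paths Q - tips ord I"
  have "\<exists>h. \<forall>p\<in>paths Q. regular_map ({} :: unit set) {q \<in> ?N. (q, p) \<in> ord} (h p) \<and>
      (\<forall>c\<in>affine_space {}. path_elem p - h p c \<in> I) \<and>
      (p \<in> ?N \<longrightarrow> h p = (\<lambda>_. path_elem p))"
  proof (rule normal_form_family)
    fix p assume "p \<in> paths Q - ?N"
    then obtain x where x: "x \<in> I" "x \<noteq> 0" "p = tip ord x" unfolding tips_def by blast
    have xs: "x \<in> Span (paths Q)" using x ideal_subset[OF I] by blast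
    define y where "y = scale (inverse (lookup x p)) x"
    have y: "y \<in> I" unfolding y_def by (rule ideal_scale[OF I x(1)])
    have "keys (path_elem p - y) \<subseteq> {q. greater ord p q}"
    proof
      fix q assume q: "q \<in> keys (path_elem p - y)"
      have "lookup x p \<noteq> 0" using tip_greatest(1)[OF xs x(2)] x(3) by (simp add: in_keys_iff)
      then have "q \<noteq> p"
        using q by (auto simp: in_keys_iff lookup_minus path_elem_def y_def)
      moreover from this have "q \<in> keys x"
        using q by (auto simp: in_keys_iff lookup_minus path_elem_def y_def lookup_single_not_eq)
      ultimately show "q \<in> {q. greater ord p q}"
        using tip_greatest(2)[OF xs x(2)] x(3) by (auto simp: greater_def)
    qed
    then have "regular_map {} {q. greater ord p q} (\<lambda>_. path_elem p - y)"
      by (rule regular_map_const)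
    then show "\<exists>e. regular_map ({} :: unit set) {q. greater ord p q} e \<and>
        (\<forall>c\<in>affine_space {}. path_elem p - e c \<in> I)"
      using y by (intro exI[of _ "\<lambda>_. path_elem p - y"]) simp
  qed (use I in auto)
  then obtain h where h: "\<forall>p\<in>paths Q. regular_map ({} :: unit set) {q \<in> ?N. (q, p) \<in> ord} (h p) \<and>
      (\<forall>c\<in>affine_space {}. path_elem p - h p c \<in> I) \<and>
      (p \<in> ?N \<longrightarrow> h p = (\<lambda>_. path_elem p))" ..
  have zero: "(0 :: unit \<Rightarrow>\<^sub>0 'k) \<in> affine_space {}" by (simp add: affine_space_def)
  have "keys (h p 0) \<subseteq> {q \<in> ?N. (q, p) \<in> ord}"
    using h p regular_map_keys[OF _ zero] by blast
  then have "h p 0 \<in> Span ?N" unfolding Span_def by blast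
  moreover have "path_elem p - h p 0 \<in> I" using h p zero by blast
  ultimately show ?thesis by blast
qed

text \<open>
  The tip of a nonzero element of \<open>I\<close> is one of its own paths, but tips of
  \<open>I\<close> are excluded from the span.
\<close>

lemma ideal_Span_nontips:
  assumes I: "ideal I (path_algebra Q :: ('v, 'e, 'k::field) qelem ring)"
    and x: "x \<in> I" "x \<in> Span (paths Q - tips ord I)"
  shows "x = 0"
proof (rule ccontr)
  assume "x \<noteq> 0"
  moreover have "x \<in> Span (paths Q)" using x(1) ideal_subset[OF I] by blast
  ultimately show False
    using tip_greatest(1) tipsI[OF x(1)] x(2) unfolding Span_def by blast
qed

lemma reduced_elem_eqI:
  assumes I: "ideal I (path_algebra Q :: ('v, 'e, 'k::field) qelem ring)"
    and g: "g \<in> I" "path_elem t - g \<in> Span (paths Q - tips ord I)"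
  shows "reduced_elem Q ord I t = g"
  unfolding reduced_elem_def
proof (rule the_equality)
  fix g' assume g': "g' \<in> I \<and> path_elem t - g' \<in> Span (paths Q - tips ord I)"
  have "g' - g \<in> I" using ideal_diff[OF I] g g' by blast
  moreover have "g' - g = (path_elem t - g) - (path_elem t - g')" by simp
  then have "g' - g \<in> Span (paths Q - tips ord I)" using g g' Span_diff by metis
  ultimately have "g' - g = 0" by (rule ideal_Span_nontips[OF I])
  then show "g' = g" by simp
qed (use g in blast)

text \<open>
  The element that defines the reduced Groebner basis is \<open>t - h\<close> for a normal form
  \<open>h\<close> of \<open>t\<close>. Its only path that is a tip of \<open>I\<close> is
  \<open>t\<close>.
\<close>

lemma tip_reduced_elem:
  assumes I: "ideal I (path_algebra Q :: ('v, 'e, 'k::field) qelem ring)" and t: "t \<in> tips ord I"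
  shows "tip ord (reduced_elem Q ord I t) = t"
proof -
  have tp: "t \<in> paths Q" using t tips_subset[OF ideal_subset[OF I]] by blast
  obtain h where h: "h \<in> Span (paths Q - tips ord I)" "path_elem t - h \<in> I"
    using ideal_normal_form[OF I tp] by blast
  define g where "g = path_elem t - h"
  have g: "g \<in> I" using h by (simp add: g_def)
  have "reduced_elem Q ord I t = g"
    by (rule reduced_elem_eqI[OF I]) (use h in \<open>simp_all add: g_def\<close>)
  moreover have "tip ord g = t"
  proof -
    have "t \<notin> keys h" using h(1) t by (auto simp: Span_def)
    then have "lookup g t = 1" by (simp add: g_def lookup_minus path_elem_def in_keys_iff)
    then have g0: "g \<noteq> 0" by auto
    have gs: "g \<in> Span (paths Q)" using g ideal_subset[OF I] by blast
    have "tip ord g \<notin> keys h"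
      using tipsI[OF g g0] h(1) unfolding Span_def by blast
    moreover have "lookup g (tip ord g) \<noteq> 0"
      using tip_greatest(1)[OF gs g0] by (simp add: in_keys_iff)
    ultimately show ?thesis
      by (auto simp: g_def lookup_minus path_elem_def in_keys_iff lookup_single when_def
          split: if_splits)
  qed
  ultimately show ?thesis by simp
qed

section \<open>Normal forms detect reduced Groebner bases\<close>

lemma upper_normal_paths: "normal_paths Q T = paths Q - upper T"
  unfolding normal_paths_def upper_def by blast

lemma minimal_paths_upper:
  assumes T: "T \<subseteq> paths Q" and antichain: "\<And>t u. t \<in> T \<Longrightarrow> u \<in> T \<Longrightarrow> subpath Q t u \<Longrightarrow> t = u"
  shows "minimal_paths (upper T) = T"
proof (intro subset_antisym subsetI)
  fix p assume p: "p \<in> minimal_paths (upper T)"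
  then obtain t where t: "t \<in> T" "subpath Q t p"
    unfolding minimal_paths_def upper_def by blast
  moreover have "t \<in> upper T" using t(1) T subpath_refl unfolding upper_def by blast
  ultimately have "t = p" using p unfolding minimal_paths_def by blast
  then show "p \<in> T" using t(1) by simp
next
  fix t assume t: "t \<in> T"
  have "u = t" if u: "u \<in> upper T" "subpath Q u t" for u
  proof -
    obtain t' where t': "t' \<in> T" "subpath Q t' u" using u(1) unfolding upper_def by blast
    have "subpath Q t' t" using subpath_trans[OF _ t'(2) u(2)] t'(1) T by blast
    then have "t' = t" using antichain t'(1) t by blast
    then show "u = t" using subpath_antisym t'(2) u(2) by blast
  qed
  moreover have "t \<in> upper T" using t T subpath_refl unfolding upper_def by blast
  ultimately show "t \<in> minimal_paths (upper T)" unfolding minimal_paths_def by blast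
qed

text \<open>
  If the \<open>g\<^sub>t\<close> are the reduced Groebner basis of \<open>I\<close>, comparing
  tips shows that \<open>T\<close> is the set of minimal tips; then the normal paths are the
  non-tips, which are independent modulo \<open>I\<close>. Conversely, if \<open>I\<close>
  contains no nonzero normal element, then no tip of \<open>I\<close> is normal: the normal form
  of an element with normal tip \<open>p\<close> would be a normal element of \<open>I\<close>
  with the same nonzero coefficient at \<open>p\<close>, because normal forms of smaller paths
  do not involve \<open>p\<close>. So the tips are the paths above \<open>T\<close>, their
  minimal elements are \<open>T\<close>, and each \<open>g\<^sub>t\<close> satisfies the
  condition that characterises the reduced element.
\<close>

lemma reduced_groebner_basis_iff:
  fixes g :: "('v, 'e) qpath \<Rightarrow> ('v, 'e, 'k::field) qelem"
  assumes I: "ideal I (path_algebra Q)"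
    and T: "T \<subseteq> paths Q"
    and antichain: "\<And>t u. t \<in> T \<Longrightarrow> u \<in> T \<Longrightarrow> subpath Q t u \<Longrightarrow> t = u"
    and gI: "\<And>t. t \<in> T \<Longrightarrow> g t \<in> I"
    and g: "\<And>t. t \<in> T \<Longrightarrow> path_elem t - g t \<in> Span {n \<in> normal_paths Q T. greater ord t n}"
    and h: "\<And>p. p \<in> paths Q \<Longrightarrow> h p \<in> Span {q \<in> normal_paths Q T. (q, p) \<in> ord}"
    and hI: "\<And>p. p \<in> paths Q \<Longrightarrow> path_elem p - h p \<in> I"
    and hN: "\<And>p. p \<in> normal_paths Q T \<Longrightarrow> h p = path_elem p"
  shows "g ` T = reduced_groebner_basis Q ord I \<longleftrightarrow> I \<inter> Span (normal_paths Q T) = {0}"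
proof -
  let ?N = "normal_paths Q T"
  have tip_g: "tip ord (g t) = t" "g t \<noteq> 0" if t: "t \<in> T" for t
  proof -
    have "path_elem t - g t \<in> Span {n. greater ord t n}"
      using g[OF t] unfolding Span_def by blast
    then have "tip ord (path_elem t - (path_elem t - g t)) = t"
      "path_elem t - (path_elem t - g t) \<noteq> 0"
      using tip_path_elem_diff[of t "path_elem t - g t"] t T by blast+
    then show "tip ord (g t) = t" "g t \<noteq> 0" by simp_all
  qed
  show ?thesis
  proof
    assume G: "g ` T = reduced_groebner_basis Q ord I"
    have min: "min_tips Q ord I \<subseteq> tips ord I"
      unfolding min_tips_eq[OF I] minimal_paths_def by blast
    have "T = tip ord ` g ` T"
      by (simp add: image_image tip_g cong: image_cong)
    also have "\<dots> = tip ord ` reduced_elem Q ord I ` min_tips Q ord I"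
      unfolding G reduced_groebner_basis_def ..
    also have "\<dots> = (\<lambda>t. t) ` min_tips Q ord I"
      unfolding image_image by (rule image_cong[OF refl]) (use min tip_reduced_elem[OF I] in blast)
    finally have "T = minimal_paths (tips ord I)" by (simp add: min_tips_eq[OF I])
    then have "upper T = tips ord I"
      using upper_minimal_paths[OF tips_subset[OF ideal_subset[OF I]] tips_upper[OF I]] by simp
    then show "I \<inter> Span ?N = {0}"
      using ideal_Span_nontips[OF I] I unfolding upper_normal_paths ideal_iff by auto
  next
    assume zero: "I \<inter> Span ?N = {0}"
    have "tips ord I = upper T"
    proof
      have "t \<in> tips ord I" if "t \<in> T" for t
        using tipsI[OF gI tip_g(2), OF that that] tip_g(1)[OF that] by simp
      then have "T \<subseteq> tips ord I" by blast
      then have "upper T \<subseteq> upper (tips ord I)" unfolding upper_def by blast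
      then show "upper T \<subseteq> tips ord I" by (simp only: tips_upper[OF I])
      show "tips ord I \<subseteq> upper T"
      proof
        fix p assume p_tip: "p \<in> tips ord I"
        then obtain x where x: "x \<in> I" "x \<noteq> 0" "p = tip ord x" unfolding tips_def by blast
        have xs: "x \<in> Span (paths Q)" using x ideal_subset[OF I] by blast
        have xp: "q \<in> paths Q" if "q \<in> keys x" for q using xs that unfolding Span_def by blast
        have pk: "p \<in> keys x" and max: "\<And>q. q \<in> keys x \<Longrightarrow> (q, p) \<in> ord"
          using tip_greatest[OF xs x(2)] x(3) by simp_all
        show "p \<in> upper T"
        proof (rule ccontr)
          assume "p \<notin> upper T"
          then have pN: "p \<in> ?N" using xp[OF pk] by (simp add: upper_normal_paths)
          have "linext h x \<in> I"
            by (rule ideal_linext_congruent[OF I x(1)]) (rule hI[OF xp])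
          moreover have "linext h x \<in> Span ?N"
            by (rule Span_linext) (use h xp in \<open>auto simp: Span_def\<close>)
          ultimately have "linext h x = 0" using zero by auto
          moreover have "lookup (linext h x) p = (\<Sum>q\<in>keys x. if q = p then lookup x p else 0)"
            unfolding lookup_linext_keys
          proof (rule sum.cong[OF refl])
            fix q assume q: "q \<in> keys x"
            have "lookup (h q) p = 0" if "q \<noteq> p"
            proof -
              have "(p, q) \<notin> ord" using that max[OF q] ord_antisym by blast
              then have "p \<notin> keys (h q)" using h[OF xp[OF q]] unfolding Span_def by blast
              then show ?thesis by (simp add: in_keys_iff)
            qed
            then show "lookup x q * lookup (h q) p = (if q = p then lookup x p else 0)"
              using hN[OF pN] by (auto simp: path_elem_def)
          qed
          ultimately show False using pk by (simp add: in_keys_iff)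
        qed
      qed
    qed
    then have min: "min_tips Q ord I = T" and N: "paths Q - tips ord I = ?N"
      using min_tips_eq[OF I] minimal_paths_upper[OF T antichain]
      by (simp_all add: upper_normal_paths)
    have "reduced_elem Q ord I t = g t" if "t \<in> T" for t
    proof (rule reduced_elem_eqI[OF I gI[OF that]])
      show "path_elem t - g t \<in> Span (paths Q - tips ord I)"
        using g[OF that] unfolding N Span_def by blast
    qed
    then show "g ` T = reduced_groebner_basis Q ord I"
      unfolding reduced_groebner_basis_def min by (simp cong: image_cong)
  qed
qed

text \<open>
  The linear map \<open>h\<close> sends an element of \<open>I\<close> to a normal element of
  \<open>I\<close> and fixes normal elements. Hence it vanishes on \<open>I\<close> iff
  \<open>I\<close> has no nonzero normal element, and vanishing on \<open>I\<close> can be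
  tested on the multiples \<open>r g\<^sub>t s\<close> by \<open>sandwich_kernel_ideal\<close>.
\<close>

lemma genideal_Int_Span_eq_0_iff:
  fixes g :: "('v, 'e) qpath \<Rightarrow> ('v, 'e, 'k::field) qelem"
  assumes g: "g ` T \<subseteq> Span (paths Q)"
    and I: "I = genideal (path_algebra Q) (g ` T)"
    and N: "N \<subseteq> paths Q"
    and h: "\<And>p. p \<in> paths Q \<Longrightarrow> h p \<in> Span N"
    and hI: "\<And>p. p \<in> paths Q \<Longrightarrow> path_elem p - h p \<in> I"
    and hN: "\<And>p. p \<in> N \<Longrightarrow> h p = path_elem p"
  shows "I \<inter> Span N = {0} \<longleftrightarrow>
    (\<forall>t\<in>T. \<forall>r\<in>paths Q. \<forall>s\<in>paths Q. linext h (sandwich r s (g t)) = 0)"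
proof -
  interpret ring "path_algebra Q :: ('v, 'e, 'k) qelem ring" by (rule path_algebra_ring)
  have I_ideal: "ideal I (path_algebra Q)" unfolding I by (rule genideal_ideal) (use g in simp)
  have gI: "g t \<in> I" if "t \<in> T" for t
    unfolding I using genideal_self[of "g ` T"] g that by auto
  show ?thesis
  proof (intro iffI ballI)
    fix t r s assume zero: "I \<inter> Span N = {0}" and t: "t \<in> T" and rs: "r \<in> paths Q" "s \<in> paths Q"
    define x where "x = sandwich r s (g t)"
    have x: "x \<in> I" unfolding x_def by (rule ideal_sandwich[OF I_ideal gI[OF t] rs])
    have xp: "q \<in> paths Q" if "q \<in> keys x" for q
      using x ideal_subset[OF I_ideal] that unfolding Span_def by blast
    have "linext h x \<in> I"
      by (rule ideal_linext_congruent[OF I_ideal x]) (rule hI[OF xp])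
    moreover have "linext h x \<in> Span N"
      by (rule Span_linext) (rule h[OF xp])
    ultimately have "linext h x = 0" using zero by auto
    then show "linext h (sandwich r s (g t)) = 0" by (simp add: x_def)
  next
    assume zero: "\<forall>t\<in>T. \<forall>r\<in>paths Q. \<forall>s\<in>paths Q. linext h (sandwich r s (g t)) = 0"
    let ?J = "{x \<in> Span (paths Q). \<forall>r\<in>paths Q. \<forall>s\<in>paths Q. linext h (sandwich r s x) = 0}"
    have "I \<subseteq> ?J"
      unfolding I
    proof (rule genideal_minimal[OF sandwich_kernel_ideal])
      show "g ` T \<subseteq> ?J" using g zero by blast
    qed
    have "x = 0" if "x \<in> I" "x \<in> Span N" for x
    proof -
      have "linext h x = 0"
        by (rule linext_eq_0_if_sandwich) (use \<open>I \<subseteq> ?J\<close> that(1) in blast)+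
      moreover have "linext h x = linext path_elem x"
        by (rule linext_cong) (use hN that(2) in \<open>auto simp: Span_def\<close>)
      ultimately show ?thesis by (simp add: linext_path_elem_id)
    qed
    moreover have "0 \<in> I" using I_ideal by (simp add: ideal_iff)
    ultimately show "I \<inter> Span N = {0}" by auto
  qed
qed

section \<open>The Groebner locus is an affine variety\<close>

definition tail_elem :: "(('v, 'e) qpath \<Rightarrow> ('v, 'e) qpath set) \<Rightarrow>
    (('v, 'e) qpath \<times> ('v, 'e) qpath \<Rightarrow>\<^sub>0 'k::field) \<Rightarrow> ('v, 'e) qpath \<Rightarrow> ('v, 'e, 'k) qelem" where
  "tail_elem M c t = (\<Sum>n\<in>{n \<in> M t. lookup c (t, n) \<noteq> 0}. single n (lookup c (t, n)))"

lemma generators_tail_elem: "generators T M c = (\<lambda>t. path_elem t - tail_elem M c t) ` T"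
  unfolding generators_def tail_elem_def ..

lemma lookup_tail_elem: "lookup (tail_elem M c t) n = (if n \<in> M t then lookup c (t, n) else 0)"
proof -
  have "finite {n \<in> M t. lookup c (t, n) \<noteq> 0}"
  proof (rule finite_subset)
    show "{n \<in> M t. lookup c (t, n) \<noteq> 0} \<subseteq> snd ` keys c"
      by (force simp: in_keys_iff)
  qed simp
  then show ?thesis
    by (simp add: tail_elem_def lookup_sum lookup_single when_def sum.delta')
qed

lemma regular_map_tail_elem:
  assumes "t \<in> T"
  shows "regular_map (coeff_index T M) (M t) (\<lambda>c. tail_elem M c t :: ('v, 'e, 'k::field) qelem)"
proof (rule regular_mapI)
  fix c :: "('v, 'e) qpath \<times> ('v, 'e) qpath \<Rightarrow>\<^sub>0 'k"
  show "keys (tail_elem M c t) \<subseteq> M t"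
    by (auto simp: in_keys_iff lookup_tail_elem split: if_splits)
next
  fix F assume F: "finite F" "F \<subseteq> coeff_index T M"
  show "\<exists>K. finite K \<and> K \<subseteq> M t \<and>
      (\<forall>c\<in>affine_space F. keys (tail_elem M c t :: ('v, 'e, 'k) qelem) \<subseteq> K)"
  proof (intro exI[of _ "M t \<inter> snd ` F"] conjI ballI subsetI)
    fix c :: "('v, 'e) qpath \<times> ('v, 'e) qpath \<Rightarrow>\<^sub>0 'k" and n
    assume c: "c \<in> affine_space F" and n: "n \<in> keys (tail_elem M c t)"
    have "n \<in> M t" "(t, n) \<in> keys c"
      using n by (auto simp: in_keys_iff lookup_tail_elem split: if_splits)
    moreover from this have "(t, n) \<in> F" using c by (auto simp: affine_space_def)
    then have "n \<in> snd ` F" by force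
    ultimately show "n \<in> M t \<inter> snd ` F" by simp
  qed (use F in auto)
next
  fix n
  show "regular_function (coeff_index T M)
      (\<lambda>c. lookup (tail_elem M c t :: ('v, 'e, 'k) qelem) n)"
    unfolding lookup_tail_elem by (cases "n \<in> M t") simp_all
qed

text \<open>
  The equations are all coordinates of the normal forms of all \<open>r g\<^sub>t(c) s\<close>.
  A path that is not normal is rewritten by replacing some \<open>t \<in> T\<close> inside it by
  its tail; parallelism of \<open>t\<close> with the paths of the tail keeps the products
  nonzero, and compatibility of the order makes them smaller.
\<close>

lemma affine_variety_groebner_locus:
  fixes M :: "('v, 'e) qpath \<Rightarrow> ('v, 'e) qpath set"
  assumes T: "T \<subseteq> paths Q"
    and antichain: "\<And>t u. t \<in> T \<Longrightarrow> u \<in> T \<Longrightarrow> subpath Q t u \<Longrightarrow> t = u"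
    and M: "\<And>t. t \<in> T \<Longrightarrow> M t \<subseteq> N_set Q ord T t"
  shows "affine_variety (coeff_index T M)
    (groebner_locus Q ord T M :: (('v, 'e) qpath \<times> ('v, 'e) qpath \<Rightarrow>\<^sub>0 'k::field) set)"
proof -
  let ?A = "path_algebra Q :: ('v, 'e, 'k) qelem ring"
  let ?X = "coeff_index T M" and ?N = "normal_paths Q T"
  interpret ring ?A by (rule path_algebra_ring)
  define g :: "(('v, 'e) qpath \<times> ('v, 'e) qpath \<Rightarrow>\<^sub>0 'k) \<Rightarrow> ('v, 'e) qpath \<Rightarrow> ('v, 'e, 'k) qelem"
    where "g c t = path_elem t - tail_elem M c t" for c t
  define L where "L c = genideal ?A (g c ` T)" for c
  have gens: "generators T M c = g c ` T" for c
    by (simp add: generators_tail_elem g_def)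
  have N: "?N \<subseteq> paths Q" unfolding normal_paths_def by blast
  have M_greater: "n \<in> ?N" "parallel Q n t" "greater ord t n" if "t \<in> T" "n \<in> M t" for t n
    using M[OF that(1)] that(2) unfolding N_set_def by blast+
  have tail_keys: "keys (tail_elem M c t) \<subseteq> M t" for c :: "_ \<Rightarrow>\<^sub>0 'k" and t
    by (auto simp: in_keys_iff lookup_tail_elem split: if_splits)
  have g_Span: "g c t \<in> Span (paths Q)" if t: "t \<in> T" for c t
    unfolding g_def
  proof (rule Span_diff)
    show "tail_elem M c t \<in> Span (paths Q)"
      using tail_keys[of c t] M_greater(1)[OF t] N unfolding Span_def by blast
  qed (use T t in auto)
  then have g_sub: "g c ` T \<subseteq> Span (paths Q)" for c by blast
  have L_ideal: "ideal (L c) ?A" for c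
    unfolding L_def by (rule genideal_ideal) (simp add: g_sub)
  have gL: "g c t \<in> L c" if "t \<in> T" for c t
    unfolding L_def using genideal_self[of "g c ` T"] g_sub that by auto
  have "\<exists>h. \<forall>p\<in>paths Q. regular_map ?X {q \<in> ?N. (q, p) \<in> ord} (h p) \<and>
      (\<forall>c\<in>affine_space ?X. path_elem p - h p c \<in> L c) \<and>
      (p \<in> ?N \<longrightarrow> h p = (\<lambda>_. path_elem p))"
  proof (rule normal_form_family)
    fix p assume "p \<in> paths Q - ?N"
    then obtain t where t: "t \<in> T" "subpath Q t p" unfolding normal_paths_def by blast
    then obtain r s where rs: "r \<in> paths Q" "s \<in> paths Q" "composable Q r t" "composable Q t s"
      and p: "p = conc r (conc t s)" unfolding subpath_def by blast
    have reg: "regular_map ?X {q. greater ord p q} (\<lambda>c. sandwich r s (tail_elem M c t) :: ('v, 'e, 'k) qelem)"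
      unfolding sandwich_def
    proof (rule regular_map_linext[OF regular_map_tail_elem[OF t(1)]])
      fix n assume n: "n \<in> M t"
      note n' = M_greater[OF t(1) n]
      have "composable Q r n" "composable Q n s"
        using rs composable_parallel[OF n'(2)] by simp_all
      then have "keys (sandwich_path r s n :: ('v, 'e, 'k) qelem) \<subseteq> {q. greater ord p q}"
        using greater_sandwich[OF n'(3) rs(1-4)] by (simp add: sandwich_path_def path_elem_def p)
      then show "regular_map ?X {q. greater ord p q} (\<lambda>_. sandwich_path r s n :: ('v, 'e, 'k) qelem)"
        by (rule regular_map_const)
    qed
    have "path_elem p - sandwich r s (tail_elem M c t) \<in> L c" for c
    proof -
      have "sandwich r s (g c t) \<in> L c"
        by (rule ideal_sandwich[OF L_ideal gL[OF t(1)] rs(1,2)])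
      then show ?thesis
        using rs by (simp add: g_def sandwich_def linext_diff sandwich_path_def p)
    qed
    with reg show "\<exists>e. regular_map ?X {q. greater ord p q} e \<and>
        (\<forall>c\<in>affine_space ?X. path_elem p - e c \<in> L c)"
      by (intro exI[of _ "\<lambda>c. sandwich r s (tail_elem M c t)"]) simp
  qed (use L_ideal N in auto)
  then obtain h where h: "\<forall>p\<in>paths Q. regular_map ?X {q \<in> ?N. (q, p) \<in> ord} (h p) \<and>
      (\<forall>c\<in>affine_space ?X. path_elem p - h p c \<in> L c) \<and>
      (p \<in> ?N \<longrightarrow> h p = (\<lambda>_. path_elem p))" ..
  have h_reg: "regular_map ?X {q \<in> ?N. (q, p) \<in> ord} (h p)"
    and h_L: "\<And>c. c \<in> affine_space ?X \<Longrightarrow> path_elem p - h p c \<in> L c"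
    and h_N: "p \<in> ?N \<Longrightarrow> h p = (\<lambda>_. path_elem p)"
    if "p \<in> paths Q" for p
    using bspec[OF h that] by simp_all
  (* For each path h is chosen once, independently of c, so each of these is a single function
     of c. *)
  define E where "E = {\<lambda>c. lookup (linext (\<lambda>p. h p c) (sandwich r s (g c t))) q | r s t q.
    r \<in> paths Q \<and> s \<in> paths Q \<and> t \<in> T}"
  have "regular_function ?X f" if "f \<in> E" for f
  proof -
    obtain r s t q where rs: "r \<in> paths Q" "s \<in> paths Q" and t: "t \<in> T"
      and f: "f = (\<lambda>c. lookup (linext (\<lambda>p. h p c) (sandwich r s (g c t))) q)"
      using \<open>f \<in> E\<close> unfolding E_def by blast
    have "regular_map ?X (paths Q) (\<lambda>c. g c t)"
      unfolding g_def
    proof (rule regular_map_diff)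
      show "regular_map ?X (paths Q) (\<lambda>c. tail_elem M c t :: ('v, 'e, 'k) qelem)"
        by (rule regular_map_mono[OF regular_map_tail_elem[OF t]]) (use M_greater(1)[OF t] N in blast)
    qed (rule regular_map_const, use t T in \<open>auto simp: path_elem_def\<close>)
    then have "regular_map ?X (paths Q) (\<lambda>c. sandwich r s (g c t))"
      unfolding sandwich_def
    proof (rule regular_map_linext)
      fix p assume "p \<in> paths Q"
      then have "sandwich_path r s p \<in> (Span (paths Q) :: ('v, 'e, 'k) qelem set)"
        using rs by (simp add: sandwich_path_def conc_in_paths)
      then show "regular_map ?X (paths Q) (\<lambda>_. sandwich_path r s p :: ('v, 'e, 'k) qelem)"
        by (intro regular_map_const) (simp add: Span_def)
    qed
    then have "regular_map ?X ?N (\<lambda>c. linext (\<lambda>p. h p c) (sandwich r s (g c t)))"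
      by (rule regular_map_linext) (rule regular_map_mono[OF h_reg], auto)
    then show ?thesis
      unfolding f by (rule regular_map_coord)
  qed
  moreover have "groebner_locus Q ord T M = {c \<in> affine_space ?X. \<forall>f\<in>E. f c = 0}"
  proof -
    have "g c ` T = reduced_groebner_basis Q ord (L c) \<longleftrightarrow> (\<forall>f\<in>E. f c = 0)"
      if c: "c \<in> affine_space ?X" for c
    proof -
      have hc: "h p c \<in> Span {q \<in> ?N. (q, p) \<in> ord}" if "p \<in> paths Q" for p
        using regular_map_keys[OF h_reg[OF that] c] unfolding Span_def by simp
      have hL: "path_elem p - h p c \<in> L c" if "p \<in> paths Q" for p
        by (rule h_L[OF that c])
      have hN: "h p c = path_elem p" if p: "p \<in> ?N" for p
      proof -
        have "p \<in> paths Q" using p N by blast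
        from h_N[OF this p] show ?thesis by simp
      qed
      have "g c ` T = reduced_groebner_basis Q ord (L c) \<longleftrightarrow> L c \<inter> Span ?N = {0}"
      proof (rule reduced_groebner_basis_iff[OF L_ideal T antichain gL _ hc hL hN])
        fix t assume t: "t \<in> T"
        show "path_elem t - g c t \<in> Span {n \<in> ?N. greater ord t n}"
          using tail_keys[of c t] M_greater[OF t] unfolding g_def Span_def by auto
      qed
      also have "\<dots> \<longleftrightarrow> (\<forall>t\<in>T. \<forall>r\<in>paths Q. \<forall>s\<in>paths Q.
          linext (\<lambda>p. h p c) (sandwich r s (g c t)) = 0)"
      proof (rule genideal_Int_Span_eq_0_iff[OF g_sub _ N _ hL hN])
        show "h p c \<in> Span ?N" if "p \<in> paths Q" for p
          using hc[OF that] unfolding Span_def by blast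
      qed (simp_all add: L_def)
      also have "\<dots> \<longleftrightarrow> (\<forall>f\<in>E. f c = 0)"
      proof
        assume "\<forall>f\<in>E. f c = 0"
        then have "lookup (linext (\<lambda>p. h p c) (sandwich r s (g c t))) q = 0"
          if "t \<in> T" "r \<in> paths Q" "s \<in> paths Q" for r s t q
        proof -
          have "(\<lambda>c. lookup (linext (\<lambda>p. h p c) (sandwich r s (g c t))) q) \<in> E"
            unfolding E_def using that
            by (intro CollectI exI[of _ r] exI[of _ s] exI[of _ t] exI[of _ q] conjI refl)
          from bspec[OF \<open>\<forall>f\<in>E. f c = 0\<close> this] show ?thesis .
        qed
        then show "\<forall>t\<in>T. \<forall>r\<in>paths Q. \<forall>s\<in>paths Q.
            linext (\<lambda>p. h p c) (sandwich r s (g c t)) = 0"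
          by (intro ballI poly_mapping_eqI) simp
      qed (auto simp: E_def)
      finally show ?thesis .
    qed
    then show ?thesis
      unfolding groebner_locus_def gens L_def[symmetric] by (simp cong: conj_cong)
  qed
  ultimately show ?thesis
    unfolding affine_variety_def by (intro exI[of _ E] conjI ballI)
qed

end

section \<open>Coordinate subspaces and weights\<close>

text \<open>
  The inclusion into the larger space and the coordinate projection back are regular and
  mutually inverse on points of the subspace.
\<close>

lemma variety_iso_coordinate_subspace:
  fixes V :: "('i \<Rightarrow>\<^sub>0 'k::field) set"
  assumes XY: "X \<subseteq> Y" and V: "V \<subseteq> affine_space X"
  shows "variety_iso X V Y V"
proof -
  define proj :: "('i \<Rightarrow>\<^sub>0 'k) \<Rightarrow> ('i \<Rightarrow>\<^sub>0 'k)"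
    where "proj c = linext (\<lambda>i. if i \<in> X then single i 1 else 0) c" for c
  have "regular_map Y X proj"
    unfolding proj_def
  proof (rule regular_map_linext[OF regular_map_id])
    fix i
    show "regular_map Y X (\<lambda>_. if i \<in> X then single i (1 :: 'k) else 0)"
      by (rule regular_map_const) auto
  qed
  moreover have "regular_map X Y (\<lambda>c. c :: 'i \<Rightarrow>\<^sub>0 'k)"
    by (rule regular_map_mono[OF regular_map_id XY])
  moreover have "proj c = c" if "c \<in> V" for c
  proof (rule poly_mapping_eqI)
    fix k
    have "keys c \<subseteq> X" using V that by (auto simp: affine_space_def)
    then have "lookup (proj c) k = (\<Sum>i\<in>keys c. if i = k then lookup c k else 0)"
      unfolding proj_def lookup_linext_keys
      by (intro sum.cong refl) (auto simp: lookup_single when_def)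
    then show "lookup (proj c) k = lookup c k"
      by (simp add: in_keys_iff)
  qed
  ultimately show ?thesis
    unfolding variety_iso_def by (intro exI[of _ "\<lambda>c. c"] exI[of _ proj]) auto
qed

lemma generators_cong_support:
  assumes "\<And>t. t \<in> T \<Longrightarrow> M t \<subseteq> M' t" "c \<in> affine_space (coeff_index T M)"
  shows "generators T M c = generators T M' c"
proof -
  have "{n \<in> M t. lookup c (t, n) \<noteq> 0} = {n \<in> M' t. lookup c (t, n) \<noteq> 0}" if "t \<in> T" for t
    using assms(1)[OF that] assms(2) by (auto simp: affine_space_def coeff_index_def in_keys_iff)
  then show ?thesis
    unfolding generators_def by (simp cong: image_cong)
qed

text \<open>
  Vanishing of the coordinates outside \<open>M\<close> means being supported on
  \<open>M\<close>, and for such families both index sets give the same generators, hence the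
  same Groebner condition.
\<close>

lemma groebner_locus_restrict:
  fixes T :: "('v, 'e) qpath set"
  assumes "\<And>t. t \<in> T \<Longrightarrow> M t \<subseteq> M' t"
  shows "(groebner_locus Q ord T M :: (('v, 'e) qpath \<times> ('v, 'e) qpath \<Rightarrow>\<^sub>0 'k::field) set) =
    {c \<in> groebner_locus Q ord T M'. \<forall>t\<in>T. \<forall>n\<in>M' t - M t. lookup c (t, n) = 0}"
proof -
  have supp: "c \<in> affine_space (coeff_index T M) \<longleftrightarrow>
      c \<in> affine_space (coeff_index T M') \<and> (\<forall>t\<in>T. \<forall>n\<in>M' t - M t. lookup c (t, n) = 0)"
    for c :: "('v, 'e) qpath \<times> ('v, 'e) qpath \<Rightarrow>\<^sub>0 'k"
  proof
    assume *: "c \<in> affine_space (coeff_index T M)"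
    have "keys c \<subseteq> coeff_index T M'"
      using * assms unfolding affine_space_def coeff_index_def by blast
    moreover have "lookup c (t, n) = 0" if "n \<notin> M t" for t n
      using * that by (auto simp: affine_space_def coeff_index_def in_keys_iff)
    ultimately show "c \<in> affine_space (coeff_index T M') \<and>
        (\<forall>t\<in>T. \<forall>n\<in>M' t - M t. lookup c (t, n) = 0)"
      by (simp add: affine_space_def)
  next
    assume *: "c \<in> affine_space (coeff_index T M') \<and>
        (\<forall>t\<in>T. \<forall>n\<in>M' t - M t. lookup c (t, n) = 0)"
    show "c \<in> affine_space (coeff_index T M)"
      unfolding affine_space_def
    proof (intro CollectI subsetI)
      fix i assume i: "i \<in> keys c"
      obtain t n where tn: "i = (t, n)" by (cases i)
      have "t \<in> T" "n \<in> M' t"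
        using * i unfolding affine_space_def coeff_index_def tn by auto
      moreover have "lookup c (t, n) \<noteq> 0" using i by (simp add: tn in_keys_iff)
      ultimately show "i \<in> coeff_index T M"
        using * unfolding coeff_index_def tn by auto
    qed
  qed
  show ?thesis
  proof (rule Set.set_eqI)
    fix c :: "('v, 'e) qpath \<times> ('v, 'e) qpath \<Rightarrow>\<^sub>0 'k"
    have "generators T M c = generators T M' c" if "c \<in> affine_space (coeff_index T M)"
      by (rule generators_cong_support[OF assms that])
    then show "c \<in> groebner_locus Q ord T M \<longleftrightarrow> c \<in> {c \<in> groebner_locus Q ord T M'.
        \<forall>t\<in>T. \<forall>n\<in>M' t - M t. lookup c (t, n) = 0}"
      using supp[of c] by (cases "c \<in> affine_space (coeff_index T M)") (auto simp: groebner_locus_def)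
  qed
qed

theorem theorem6p7:
  fixes Q :: "('v, 'e) pre_digraph"
    and ord :: "('v, 'e) qpath rel"
    and G :: "('g, 'm) monoid_scheme"
    and W :: "'e \<Rightarrow> 'g"
    and T :: "('v, 'e) qpath set"
    and S :: "('v, 'e) qpath \<Rightarrow> ('v, 'e) qpath set"
    and \<phi> :: "('v, 'e) qpath \<Rightarrow> ('v, 'e) qpath \<Rightarrow> 'k::field"
  assumes "fin_digraph Q"
    and "admissible_order Q ord"
    and "group G"
    and "W \<in> arcs Q \<rightarrow> carrier G"
    and "T \<subseteq> paths Q"
    and "finite T"
    and "tip_reduced Q ord ((path_elem :: _ \<Rightarrow> ('v, 'e, 'k) qelem) ` T)"
    and "\<forall>t\<in>T. 2 \<le> path_length t"
    and "\<forall>t\<in>T. S t = N_set Q ord T t - NW_set Q ord G W T t"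
    and "\<forall>t\<in>T. \<forall>n\<in>S t. \<phi> t n = 0"
  shows "variety_iso
           (coeff_index T (NW_set Q ord G W T)) (V_TW Q ord G W T)
           (coeff_index T (N_set Q ord T)) (V_T_phi Q ord T S \<phi>)
       \<and> special_subvariety Q ord T
           (V_TW Q ord G W T :: (('v, 'e) qpath \<times> ('v, 'e) qpath \<Rightarrow>\<^sub>0 'k) set)
       \<and> affine_variety (coeff_index T (NW_set Q ord G W T))
           (V_TW Q ord G W T :: (('v, 'e) qpath \<times> ('v, 'e) qpath \<Rightarrow>\<^sub>0 'k) set)"
proof -
  let ?N = "N_set Q ord T" and ?NW = "NW_set Q ord G W T"
  let ?V = "V_TW Q ord G W T :: (('v, 'e) qpath \<times> ('v, 'e) qpath \<Rightarrow>\<^sub>0 'k) set"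
  interpret fin_digraph Q by (rule assms(1))
  interpret ordered_quiver Q ord
    by unfold_locales (rule assms(2))
  have sub: "?NW t \<subseteq> ?N t" for t
    unfolding NW_set_def N_set_def by blast
  have "V_T_phi Q ord T S \<phi> =
      {c \<in> groebner_locus Q ord T ?N. \<forall>t\<in>T. \<forall>n\<in>?N t - ?NW t. lookup c (t, n) = 0}"
    unfolding V_T_phi_def V_T_def using assms(9,10) by simp
  then have eq: "?V = V_T_phi Q ord T S \<phi>"
    unfolding V_TW_def using groebner_locus_restrict[OF sub, where ?'k = 'k] by simp
  have "variety_iso (coeff_index T ?NW) ?V (coeff_index T ?N) ?V"
  proof (rule variety_iso_coordinate_subspace)
    show "coeff_index T ?NW \<subseteq> coeff_index T ?N"
      unfolding coeff_index_def using sub by blast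
    show "?V \<subseteq> affine_space (coeff_index T ?NW)"
      unfolding V_TW_def groebner_locus_def by blast
  qed
  moreover have "special_subvariety Q ord T ?V"
    unfolding special_subvariety_def using eq assms(9) by blast
  moreover have "affine_variety (coeff_index T ?NW) ?V"
    unfolding V_TW_def
  proof (rule affine_variety_groebner_locus[OF assms(5)])
    fix t u assume tu: "t \<in> T" "u \<in> T" "subpath Q t u"
    let ?e = "path_elem :: ('v, 'e) qpath \<Rightarrow> ('v, 'e, 'k) qelem"
    have "t \<in> paths Q" "u \<in> paths Q" using tu assms(5) by auto
    then have tips: "tip ord (?e t) = t" "tip ord (?e u) = u" by simp_all
    have "?e p \<noteq> 0" for p
    proof
      assume "?e p = 0"
      then have "lookup (?e p) p = lookup 0 p" by simp
      then show False by (simp add: path_elem_def)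
    qed
    then have "?e t = ?e u"
      using assms(7) tu tips unfolding tip_reduced_def by (metis imageI)
    then show "t = u" using tips by metis
  qed (rule sub)
  ultimately show ?thesis
    using eq by simp
qed

end
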